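(* Let $\Gamma\in\mathscr G_3$ be a triregular graph. Then the coherent closure $\mathcal W(\Gamma)$ has rank at least $14$.
   Context: All graphs are finite, undirected and simple; eigenvalues are those of the adjacency matrix $A(\Gamma)$. $\mathscr G_3$ denotes the set of all connected graphs having precisely three distinct eigenvalues. A graph is triregular if its vertices have exactly three distinct degrees. A coherent algebra on a finite set $X$ is a matrix algebra $\mathcal A\subset \operatorname{Mat}_X(\mathbb C)$ that contains the identity matrix $I$ and the all-ones matrix $J$, and is closed under transposition, ordinary matrix multiplication and entrywise multiplication. Each coherent algebra has a unique linear basis consisting of $\{0,1\}$-matrices whose sum is $J$; the number of these matrices is the rank of $\mathcal A$. The coherent closure $\mathcal W(\Gamma)$ of $\Gamma$ is the smallest coherent algebra containing $A(\Gamma)$. *)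

theory Defs
  imports "HOL-Analysis.Analysis"
begin

text \<open>
  A graph is given by its adjacency relation on a finite vertex type. Loops are excluded
  by irreflexivity, and multiple edges cannot occur.
\<close>

definition simple_graph :: "('v::finite \<Rightarrow> 'v \<Rightarrow> bool) \<Rightarrow> bool" where
  "simple_graph E \<longleftrightarrow> irreflp E \<and> symp E"

definition connected_graph :: "('v::finite \<Rightarrow> 'v \<Rightarrow> bool) \<Rightarrow> bool" where
  "connected_graph E \<longleftrightarrow> (\<forall>u v. E\<^sup>*\<^sup>* u v)"

definition degree :: "('v::finite \<Rightarrow> 'v \<Rightarrow> bool) \<Rightarrow> 'v \<Rightarrow> nat" where
  "degree E v = card {w. E v w}"

definition adjacency_matrix :: "('v::finite \<Rightarrow> 'v \<Rightarrow> bool) \<Rightarrow> complex ^ 'v ^ 'v" where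
  "adjacency_matrix E = (\<chi> u v. if E u v then 1 else 0)"

definition eigenvalues :: "complex ^ 'v ^ 'v \<Rightarrow> complex set" where
  "eigenvalues M = {k. \<exists>x. x \<noteq> 0 \<and> M *v x = k *s x}"

definition in_G3 :: "('v::finite \<Rightarrow> 'v \<Rightarrow> bool) \<Rightarrow> bool" where
  "in_G3 E \<longleftrightarrow> simple_graph E \<and> connected_graph E \<and> card (eigenvalues (adjacency_matrix E)) = 3"

definition triregular :: "('v::finite \<Rightarrow> 'v \<Rightarrow> bool) \<Rightarrow> bool" where
  "triregular E \<longleftrightarrow> card (range (degree E)) = 3"

text \<open>
  The matrices form a vector space over the complex numbers; the library only provides
  scalar multiplication by complex numbers for vectors and by real numbers for matrices.
\<close>

interpretation cmat: vector_space "\<lambda>c :: complex. map_matrix ((*) c) :: complex ^ 'v::finite ^ 'v \<Rightarrow> _"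
  by unfold_locales (simp_all add: vec_eq_iff map_matrix_def algebra_simps)

text \<open>
  On type \<open>complex ^ 'v ^ 'v\<close> the library operations \<open>*\<close> and \<open>1\<close> are entrywise:
  \<open>M * N\<close> is the entrywise product and \<open>1\<close> is the all-ones matrix \<open>J\<close>
  (see the two lemmas below). The matrix product is \<open>**\<close> and the identity matrix is \<open>mat 1\<close>.
\<close>

lemma times_matrix_nth: "(M * N) $ i $ j = M $ i $ j * N $ i $ j"
  for M N :: "complex ^ 'v::finite ^ 'v"
  by simp

lemma one_matrix_nth: "(1 :: complex ^ 'v::finite ^ 'v) $ i $ j = 1"
  by simp

definition coherent_algebra :: "(complex ^ 'v ^ 'v) set \<Rightarrow> bool" where
  "coherent_algebra A \<longleftrightarrow>
     cmat.subspace A \<and> mat 1 \<in> A \<and> 1 \<in> A \<and>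
     (\<forall>M\<in>A. transpose M \<in> A) \<and>
     (\<forall>M\<in>A. \<forall>N\<in>A. M ** N \<in> A) \<and>
     (\<forall>M\<in>A. \<forall>N\<in>A. M * N \<in> A)"

definition standard_basis :: "(complex ^ 'v ^ 'v) set \<Rightarrow> (complex ^ 'v ^ 'v) set \<Rightarrow> bool" where
  "standard_basis A B \<longleftrightarrow>
     cmat.independent B \<and> cmat.span B = A \<and>
     (\<forall>M\<in>B. \<forall>i j. M $ i $ j \<in> {0, 1}) \<and> (\<Sum>M\<in>B. M) = 1"

definition coherent_rank :: "(complex ^ 'v ^ 'v) set \<Rightarrow> nat" where
  "coherent_rank A = card (THE B. standard_basis A B)"

definition coherent_closure :: "('v::finite \<Rightarrow> 'v \<Rightarrow> bool) \<Rightarrow> (complex ^ 'v ^ 'v) set" where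
  "coherent_closure E = \<Inter>{A. coherent_algebra A \<and> adjacency_matrix E \<in> A}"

text \<open>The coherent closure is the smallest coherent algebra containing the adjacency matrix.\<close>

lemma coherent_algebra_closure: "coherent_algebra (coherent_closure E)"
  unfolding coherent_closure_def coherent_algebra_def
  by (auto intro!: cmat.subspace_Inter)

lemma adjacency_in_closure: "adjacency_matrix E \<in> coherent_closure E"
  by (auto simp: coherent_closure_def)

lemma coherent_closure_least:
  "coherent_algebra A \<Longrightarrow> adjacency_matrix E \<in> A \<Longrightarrow> coherent_closure E \<subseteq> A"
  by (auto simp: coherent_closure_def)

text \<open>
  Every coherent algebra has exactly one standard basis: its members are the indicator
  matrices of the classes of positions that no matrix of the algebra separates.
\<close>

definition same_pos :: "(complex ^ 'v ^ 'v) set \<Rightarrow> 'v \<times> 'v \<Rightarrow> 'v \<times> 'v \<Rightarrow> bool" where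
  "same_pos A p q \<longleftrightarrow> (\<forall>M\<in>A. M $ fst p $ snd p = M $ fst q $ snd q)"

definition pos_indicator :: "(complex ^ 'v ^ 'v) set \<Rightarrow> 'v \<times> 'v \<Rightarrow> complex ^ 'v ^ 'v" where
  "pos_indicator A p = (\<chi> i j. if same_pos A p (i, j) then 1 else 0)"

lemma finite_zero_one_matrices:
  "finite {M :: complex ^ 'v::finite ^ 'v. \<forall>i j. M $ i $ j \<in> {0, 1}}" (is "finite ?S")
proof (rule finite_surj)
  show "finite (UNIV :: ('v \<times> 'v) set set)" by simp
  show "?S \<subseteq> (\<lambda>P. \<chi> i j. if (i, j) \<in> P then 1 else 0) ` UNIV"
  proof
    fix M assume "M \<in> ?S"
    then have "M = (\<chi> i j. if (i, j) \<in> {(i, j). M $ i $ j = 1} then 1 else 0)"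
      by (auto simp: vec_eq_iff)
    then show "M \<in> (\<lambda>P. \<chi> i j. if (i, j) \<in> P then 1 else 0) ` UNIV" by blast
  qed
qed

lemma pos_indicator_eq_iff: "pos_indicator A p = pos_indicator A q \<longleftrightarrow> same_pos A p q"
proof
  assume "pos_indicator A p = pos_indicator A q"
  then have "pos_indicator A p $ fst q $ snd q = pos_indicator A q $ fst q $ snd q" by simp
  then show "same_pos A p q" by (simp add: pos_indicator_def same_pos_def split: if_splits)
qed (simp add: pos_indicator_def same_pos_def)

lemma pos_indicator_nth:
  "pos_indicator A p $ i $ j = (if pos_indicator A p = pos_indicator A (i, j) then 1 else 0)"
  unfolding pos_indicator_eq_iff by (simp add: pos_indicator_def)

lemma sum_pos_indicator:
  "(\<Sum>M\<in>range (pos_indicator A). c M * M $ i $ j) = c (pos_indicator A (i, j))"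
proof -
  have "(\<Sum>M\<in>range (pos_indicator A). c M * M $ i $ j) =
        (\<Sum>M\<in>range (pos_indicator A). if M = pos_indicator A (i, j) then c M else 0)"
    by (rule sum.cong) (auto simp: pos_indicator_nth)
  then show ?thesis by simp
qed

lemma pos_indicator_in:
  assumes "coherent_algebra A"
  shows "pos_indicator A p \<in> A"
proof -
  have sub: "cmat.subspace A" and one: "1 \<in> A" and had: "\<And>M N. M \<in> A \<Longrightarrow> N \<in> A \<Longrightarrow> M * N \<in> A"
    using assms by (auto simp: coherent_algebra_def)
  have ex: "\<exists>N\<in>A. N $ fst p $ snd p = 1 \<and> (\<forall>q\<in>Q. N $ fst q $ snd q = 0)"
    if "finite Q" "Q \<subseteq> {q. \<not> same_pos A p q}" for Q
    using that
  proof (induction Q)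
    case empty
    then show ?case using one by (intro bexI[of _ 1]) auto
  next
    case (insert q Q)
    then obtain N where N: "N \<in> A" "N $ fst p $ snd p = 1" "\<forall>q\<in>Q. N $ fst q $ snd q = 0"
      by auto
    from insert.prems obtain M where M: "M \<in> A" "M $ fst p $ snd p \<noteq> M $ fst q $ snd q"
      by (auto simp: same_pos_def)
    define a b where "a = M $ fst p $ snd p" and "b = M $ fst q $ snd q"
    define L where "L = map_matrix ((*) (1 / (a - b))) (M - map_matrix ((*) b) 1)"
    have "L \<in> A" unfolding L_def
      by (intro cmat.subspace_scale cmat.subspace_diff sub M one)
    moreover have "L $ fst p $ snd p = 1" "L $ fst q $ snd q = 0"
      using M by (simp_all add: L_def a_def b_def map_matrix_def)
    ultimately show ?case using N had[OF N(1)]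
      by (intro bexI[of _ "N * L"]) auto
  qed
  obtain N where N: "N \<in> A" "N $ fst p $ snd p = 1"
    "\<forall>q\<in>{q. \<not> same_pos A p q}. N $ fst q $ snd q = 0"
    using ex[of "{q. \<not> same_pos A p q}"] by auto
  have "N = pos_indicator A p"
    using N by (auto simp: vec_eq_iff pos_indicator_def same_pos_def)
  with N show ?thesis by simp
qed

lemma standard_basis_pos_indicator:
  assumes "coherent_algebra A"
  shows "standard_basis A (range (pos_indicator A))" (is "standard_basis A ?B")
proof -
  have sub: "cmat.subspace A" using assms by (simp add: coherent_algebra_def)
  have comb: "(\<Sum>M\<in>?B. map_matrix ((*) (c M)) M) $ i $ j = c (pos_indicator A (i, j))" for c i j
    using sum_pos_indicator[where c = c and A = A and i = i and j = j]
    by (simp add: map_matrix_def sum_component)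
  have "cmat.independent ?B"
  proof (rule cmat.independent_if_scalars_zero)
    fix f and x
    assume 0: "(\<Sum>x\<in>?B. map_matrix ((*) (f x)) x) = 0" and "x \<in> ?B"
    then obtain i j where "x = pos_indicator A (i, j)" by auto
    then show "f x = 0" using comb[where c = f and i = i and j = j] 0 by simp
  qed simp
  moreover have "cmat.span ?B \<subseteq> A"
    by (rule cmat.span_minimal[OF _ sub]) (use pos_indicator_in[OF assms] in auto)
  moreover have "A \<subseteq> cmat.span ?B"
  proof
    fix M assume M: "M \<in> A"
    define r where "r x = (SOME p. x = pos_indicator A p)" for x
    have r: "pos_indicator A (r (pos_indicator A p)) = pos_indicator A p" for p
      unfolding r_def by (rule someI2[of _ p]) auto
    have "M $ i $ j = M $ fst (r (pos_indicator A (i, j))) $ snd (r (pos_indicator A (i, j)))" for i j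
      using r[of "(i, j)"] M unfolding pos_indicator_eq_iff same_pos_def by simp
    then have "M = (\<Sum>x\<in>?B. map_matrix ((*) (M $ fst (r x) $ snd (r x))) x)"
      by (simp only: vec_eq_iff comb[where c = "\<lambda>x. M $ fst (r x) $ snd (r x)"]) blast
    also have "\<dots> \<in> cmat.span ?B"
      by (intro cmat.span_sum cmat.span_scale cmat.span_base) auto
    finally show "M \<in> cmat.span ?B" .
  qed
  moreover have "(\<Sum>M\<in>?B. M) = 1"
    using sum_pos_indicator[where c = "\<lambda>_. 1" and A = A]
    by (simp add: vec_eq_iff)
  moreover have "\<forall>M\<in>?B. \<forall>i j. M $ i $ j \<in> {0, 1}"
    by (simp add: pos_indicator_def)
  ultimately show ?thesis
    unfolding standard_basis_def by blast
qed

lemma standard_basis_unique: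
  fixes A B :: "(complex ^ 'v::finite ^ 'v) set"
  assumes "standard_basis A B"
  shows "B = range (pos_indicator A)"
proof -
  have ind: "cmat.independent B" and span: "cmat.span B = A"
    and zo: "\<And>M i j. M \<in> B \<Longrightarrow> M $ i $ j = 0 \<or> M $ i $ j = 1" and sum: "(\<Sum>M\<in>B. M) = 1"
    using assms by (auto simp: standard_basis_def)
  have fin: "finite B"
    by (rule finite_subset[OF _ finite_zero_one_matrices]) (use zo in auto)
  have card1: "card {M \<in> B. M $ i $ j = 1} = 1" for i j
  proof -
    have "(1::complex) = (\<Sum>M\<in>B. M) $ i $ j" using sum by simp
    also have "\<dots> = (\<Sum>M\<in>B. M $ i $ j)" by simp
    also have "\<dots> = (\<Sum>M\<in>B. if M $ i $ j = 1 then 1 else 0)"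
      by (rule sum.cong) (use zo in auto)
    also have "\<dots> = of_nat (card {M \<in> B. M $ i $ j = 1})"
      using fin by (simp add: sum.If_cases Int_def)
    finally have "of_nat (card {M \<in> B. M $ i $ j = 1}) = (of_nat 1 :: complex)" by simp
    then show ?thesis by (simp only: of_nat_eq_iff)
  qed
  have ex: "\<exists>M\<in>B. M $ i $ j = 1" for i j
  proof -
    obtain M where "{M \<in> B. M $ i $ j = 1} = {M}"
      using card_1_singletonE[OF card1[where i = i and j = j]] .
    then show ?thesis by blast
  qed
  have uniq: "M = N" if "M \<in> B" "N \<in> B" "M $ i $ j = 1" "N $ i $ j = 1" for M N i j
  proof -
    obtain L where L: "{M \<in> B. M $ i $ j = 1} = {L}"
      using card_1_singletonE[OF card1[where i = i and j = j]] .
    have "M \<in> {L}" "N \<in> {L}"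
      unfolding L[symmetric] using that by simp_all
    then show ?thesis by simp
  qed
  have key: "M = pos_indicator A (i, j)" if M: "M \<in> B" "M $ i $ j = 1" for M i j
  proof -
    have MA: "M \<in> A" using M span cmat.span_base by blast
    have agree: "N $ i $ j = N $ k $ l" if kl: "M $ k $ l = 1" and N: "N \<in> A" for N k l
    proof -
      have "N \<in> cmat.span B" using N span by simp
      then show ?thesis
      proof (induction rule: cmat.span_induct_alt)
        case base
        then show ?case by simp
      next
        case (step c x y)
        have "x $ i $ j = x $ k $ l"
        proof (cases "x = M")
          case True
          then show ?thesis using M(2) kl by simp
        next
          case False
          then have "x $ i $ j \<noteq> 1" "x $ k $ l \<noteq> 1"
            using uniq[OF step(1) M(1)] M(2) kl by blast+
          then show ?thesis using zo[OF step(1), of i j] zo[OF step(1), of k l] by simp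
        qed
        with step show ?case by (simp add: map_matrix_def)
      qed
    qed
    have "same_pos A (i, j) (k, l) \<longleftrightarrow> M $ k $ l = 1" for k l
    proof
      assume "same_pos A (i, j) (k, l)"
      then show "M $ k $ l = 1" using MA M(2) by (simp add: same_pos_def)
    next
      assume "M $ k $ l = 1"
      then show "same_pos A (i, j) (k, l)" using agree unfolding same_pos_def by simp
    qed
    then have "M $ k $ l = pos_indicator A (i, j) $ k $ l" for k l
      using zo[OF M(1), of k l] by (auto simp: pos_indicator_def)
    then show ?thesis by (simp add: vec_eq_iff)
  qed
  show ?thesis
  proof
    show "B \<subseteq> range (pos_indicator A)"
    proof
      fix M assume M: "M \<in> B"
      then have "M \<noteq> 0" using ind cmat.dependent_zero by blast
      then obtain i j where "M $ i $ j = 1" using zo[OF M] unfolding vec_eq_iff zero_index by metis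
      then show "M \<in> range (pos_indicator A)" using key M by blast
    qed
    show "range (pos_indicator A) \<subseteq> B"
    proof (rule image_subsetI)
      fix p :: "'v \<times> 'v"
      obtain M where M: "M \<in> B" "M $ fst p $ snd p = 1" using ex by blast
      then have "M = pos_indicator A (fst p, snd p)" by (rule key)
      with M show "pos_indicator A p \<in> B" by simp
    qed
  qed
qed

lemma ex1_standard_basis: "coherent_algebra A \<Longrightarrow> \<exists>!B. standard_basis A B"
  using standard_basis_pos_indicator standard_basis_unique by blast

end

theory Submission
  imports Defs
begin

text \<open>
  Let \<open>B\<close> be the adjacency matrix, with largest eigenvalue \<open>\<theta>\<^sub>0\<close> and the two other eigenvalues
  \<open>\<theta>\<^sub>1\<close>, \<open>\<theta>\<^sub>2\<close>. Since \<open>\<theta>\<^sub>0\<close> is simple with a positive eigenvector, \<open>(B - \<theta>\<^sub>1 I)(B - \<theta>\<^sub>2 I)\<close> has rank one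
  and equals \<open>\<alpha> \<alpha>\<^sup>T\<close> for a positive vector \<open>\<alpha>\<close> (lemma \<open>rank_one_identity\<close>). Put
  \<open>a = \<theta>\<^sub>1 + \<theta>\<^sub>2\<close> and \<open>p = \<theta>\<^sub>1 \<theta>\<^sub>2\<close>. Entrywise the identity says that \<open>x\<close> has degree \<open>\<alpha> x * \<alpha> x - p\<close>, and that
  two distinct vertices have \<open>\<alpha> x * \<alpha> y + a\<close> or \<open>\<alpha> x * \<alpha> y\<close> common neighbours according to whether
  they are adjacent or not. So \<open>\<alpha>\<close> takes the same value at two vertices exactly when they have the
  same degree, and there are three cells of constant degree.

  The rank is the number of classes of positions that no matrix of the coherent closure separates.
  Hence any function of a pair of vertices that is constant on these classes has at most that many
  values (\<open>card_range_le_rank\<close>). If the rank is below \<open>16\<close>, the degree partition is equitable: otherwise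
  counting neighbours in a cell would distinguish at least four kinds of vertices, and so sixteen
  kinds of pairs (\<open>small_rank_equitable\<close>). For an equitable degree partition the quotient
  matrix satisfies the quotient of the rank-one identity (\<open>quotient_eq\<close>).

  If any two cells are completely joined or not joined at all, the quotient equations are
  contradictory (\<open>uniform_False\<close>). If three cells with values \<open>s1\<close>, \<open>s2\<close>, \<open>s3\<close> of \<open>\<alpha>\<close> are pairwise joined,
  then \<open>s1\<^sup>2 + s2\<^sup>2 - s1 * s2\<close> does not change when another pair of the values is taken, which forces
  \<open>s2 = s1 + s3\<close> and \<open>s3 = s1 + s2\<close>. If the cells form a path, one end cell
  is a single vertex, so is the middle cell, and the square of a value of \<open>\<alpha>\<close> is an integer strictly
  between \<open>0\<close> and \<open>1\<close>.

  Otherwise two cells are joined neither completely nor not at all. Both have at least two vertices.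
  Counting the types of pairs (\<open>mixed_card\<close>) gives at least \<open>2\<close> in each of the four blocks on these
  cells and at least \<open>1\<close> in each of the other five, that is \<open>13\<close>. If there are no more, then the
  third cell is a single vertex and the two mixed cells are complete or empty. The bipartite graph
  between the mixed cells is then a square design, and the equations are again contradictory
  (\<open>mixed_False\<close>).
\<close>

section \<open>The rank-one identity\<close>

text \<open>
  On an invariant subspace a maximizer of the Rayleigh quotient is an eigenvector: otherwise moving
  from \<open>x\<close> a short way in the direction \<open>A x - l x\<close> would increase the quotient.
\<close>

lemma symmetric_maximizer_eigenvector:
  fixes A :: "real ^ 'n ^ 'n"
  assumes sym: "transpose A = A" and S: "subspace S"
    and inv: "\<And>y. y \<in> S \<Longrightarrow> A *v y \<in> S"
    and le: "\<And>y. y \<in> S \<Longrightarrow> y \<bullet> (A *v y) \<le> l * (y \<bullet> y)"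
    and x: "x \<in> S" "x \<bullet> (A *v x) = l * (x \<bullet> x)"
  shows "A *v x = l *\<^sub>R x"
proof (rule ccontr)
  assume ne: "A *v x \<noteq> l *\<^sub>R x"
  define w where "w = A *v x - l *\<^sub>R x"
  have w: "w \<in> S" unfolding w_def by (intro subspace_diff subspace_scale inv S x)
  have ww: "w \<bullet> w > 0" using ne by (simp add: w_def)
  define q where "q = w \<bullet> (A *v w) - l * (w \<bullet> w)"
  define t where "t = (w \<bullet> w) / (\<bar>q\<bar> + 1)"
  have t: "t > 0" unfolding t_def using ww by simp
  have xAw: "x \<bullet> (A *v w) = w \<bullet> (A *v x)"
    using sym by (metis dot_lmul_matrix inner_commute transpose_matrix_vector)
  have wAx: "w \<bullet> (A *v x) = w \<bullet> w + l * (w \<bullet> x)"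
    unfolding w_def by (simp add: inner_diff_right algebra_simps)
  have "x + t *\<^sub>R w \<in> S" by (intro subspace_add subspace_scale S x w)
  from le[OF this] have "2 * t * (w \<bullet> w) + t * t * q \<le> 0"
    using x(2) xAw wAx
    by (simp add: q_def matrix_vector_right_distrib matrix_vector_mult_scaleR inner_add_left
        inner_add_right inner_commute[of x w] algebra_simps)
  then have "t * (2 * (w \<bullet> w) + t * q) \<le> 0" by (simp add: algebra_simps)
  then have "2 * (w \<bullet> w) + t * q \<le> 0" using t by (simp add: mult_le_0_iff)
  moreover have "t * (\<bar>q\<bar> + 1) = w \<bullet> w" unfolding t_def by simp
  moreover have "t * \<bar>q\<bar> \<ge> - (t * q)" using t by (metis abs_ge_minus_self abs_mult abs_of_pos)
  ultimately show False using ww t by (simp add: algebra_simps)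
qed

lemma symmetric_exists_top_eigenvector:
  fixes A :: "real ^ 'n ^ 'n"
  assumes sym: "transpose A = A" and S: "subspace S" and S0: "\<exists>y\<in>S. y \<noteq> 0"
    and inv: "\<And>y. y \<in> S \<Longrightarrow> A *v y \<in> S"
  obtains l x where "x \<in> S" "x \<noteq> 0" "A *v x = l *\<^sub>R x"
    "\<And>y. y \<in> S \<Longrightarrow> y \<bullet> (A *v y) \<le> l * (y \<bullet> y)"
proof -
  let ?K = "sphere 0 1 \<inter> S"
  have "compact ?K" by (intro compact_Int_closed closed_subspace S) simp
  moreover obtain y where y: "y \<in> S" "y \<noteq> 0" using S0 by blast
  then have "(1 / norm y) *\<^sub>R y \<in> ?K" using S by (simp add: subspace_scale)
  then have "?K \<noteq> {}" by blast
  moreover have "continuous_on ?K (\<lambda>y. y \<bullet> (A *v y))"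
    by (intro continuous_intros matrix_vector_mult_linear_continuous_on)
  ultimately obtain x where x: "x \<in> ?K" and max: "\<And>y. y \<in> ?K \<Longrightarrow> y \<bullet> (A *v y) \<le> x \<bullet> (A *v x)"
    using continuous_attains_sup[of ?K "\<lambda>y. y \<bullet> (A *v y)"] by blast
  define l where "l = x \<bullet> (A *v x)"
  have le: "y \<bullet> (A *v y) \<le> l * (y \<bullet> y)" if "y \<in> S" for y
  proof (cases "y = 0")
    case False
    define c where "c = 1 / norm y"
    have "c *\<^sub>R y \<in> ?K" using that S False by (simp add: subspace_scale c_def)
    from max[OF this] have "(c * c) * (y \<bullet> (A *v y)) \<le> l"
      by (simp add: l_def matrix_vector_mult_scaleR)
    moreover have "c * c * (y \<bullet> y) = 1"
      using False by (simp add: c_def dot_square_norm power2_eq_square)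
    moreover have "y \<bullet> y > 0" using False by simp
    ultimately have "(c * c) * (y \<bullet> (A *v y)) * (y \<bullet> y) \<le> l * (y \<bullet> y)"
      by (intro mult_right_mono) auto
    moreover have "(c * c) * (y \<bullet> (A *v y)) * (y \<bullet> y) = (c * c * (y \<bullet> y)) * (y \<bullet> (A *v y))" by simp
    ultimately show ?thesis using \<open>c * c * (y \<bullet> y) = 1\<close> by simp
  qed simp
  have xx: "x \<bullet> x = 1" using x by (simp add: dot_square_norm)
  show ?thesis
  proof (rule that)
    show "x \<in> S" "x \<noteq> 0" using x by auto
    show "A *v x = l *\<^sub>R x"
      by (rule symmetric_maximizer_eigenvector[OF sym S inv le]) (use x xx l_def in auto)
  qed (rule le)
qed

text \<open>
  Entries of the adjacency matrix as real numbers; the symmetric matrix itself is considered over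
  the reals, where the values of its quadratic form can be compared.
\<close>

definition adj :: "('v::finite \<Rightarrow> 'v \<Rightarrow> bool) \<Rightarrow> 'v \<Rightarrow> 'v \<Rightarrow> real" where
  "adj E x y = of_bool (E x y)"

definition real_adjacency :: "('v::finite \<Rightarrow> 'v \<Rightarrow> bool) \<Rightarrow> real ^ 'v ^ 'v" where
  "real_adjacency E = (\<chi> x y. adj E x y)"

lemma adj_nonneg: "adj E x y \<ge> 0" by (simp add: adj_def)

lemma real_adjacency_mult: "(real_adjacency E *v x) $ i = (\<Sum>j\<in>UNIV. adj E i j * x $ j)"
  by (simp add: real_adjacency_def matrix_vector_mult_def)

lemma transpose_real_adjacency: "symp E \<Longrightarrow> transpose (real_adjacency E) = real_adjacency E"
  by (auto simp: real_adjacency_def transpose_def vec_eq_iff adj_def dest: sympD)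

lemma connected_propagate:
  assumes "connected_graph E" "\<And>x y. P x \<Longrightarrow> E x y \<Longrightarrow> P y" "P x"
  shows "P y"
proof -
  have "E\<^sup>*\<^sup>* x y" using assms(1) by (simp add: connected_graph_def)
  then show ?thesis by (induction rule: rtranclp_induct) (use assms in blast)+
qed

text \<open>
  If a nonnegative eigenvector vanishes at a vertex, it vanishes at the neighbours of that vertex,
  and so, by connectedness, everywhere.
\<close>

lemma nonneg_eigenvector_pos:
  assumes con: "connected_graph E" and ev: "real_adjacency E *v y = l *\<^sub>R y"
    and nn: "\<And>i. y $ i \<ge> 0" and "y \<noteq> 0"
  shows "y $ i > 0"
proof (rule ccontr)
  assume "\<not> y $ i > 0"
  then have i0: "y $ i = 0" using nn[of i] by simp
  have "y $ k = 0" if "y $ j = 0" "E j k" for j k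
  proof -
    have "(\<Sum>k\<in>UNIV. adj E j k * y $ k) = 0"
      using arg_cong[OF ev, of "\<lambda>v. v $ j"] that(1) by (simp add: real_adjacency_mult)
    then have "adj E j k * y $ k = 0"
      by (subst (asm) sum_nonneg_eq_0_iff) (auto simp: adj_nonneg nn)
    then show ?thesis using that(2) by (simp add: adj_def)
  qed
  then have "y $ k = 0" for k
    using connected_propagate[where P="\<lambda>k. y $ k = 0", OF con _ i0] by blast
  then show False using \<open>y \<noteq> 0\<close> by (simp add: vec_eq_iff)
qed

text \<open>
  The vector of the absolute values of the entries.
\<close>

definition abs_vec :: "real ^ 'n \<Rightarrow> real ^ 'n" where
  "abs_vec x = (\<chi> i. \<bar>x $ i\<bar>)"

lemma top_eigenvector_abs:
  assumes sym: "symp E" and ev: "real_adjacency E *v x = l *\<^sub>R x"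
    and le: "\<And>y. y \<bullet> (real_adjacency E *v y) \<le> l * (y \<bullet> y)"
  shows "real_adjacency E *v abs_vec x = l *\<^sub>R abs_vec x"
proof (rule symmetric_maximizer_eigenvector[OF transpose_real_adjacency[OF sym] subspace_UNIV _ le])
  let ?A = "real_adjacency E"
  have "x \<bullet> (?A *v x) \<le> abs_vec x \<bullet> (?A *v abs_vec x)"
    unfolding inner_vec_def real_adjacency_mult sum_distrib_left inner_real_def abs_vec_def vec_lambda_beta
  proof (intro sum_mono)
    fix i j
    have "x $ i * (adj E i j * x $ j) \<le> \<bar>x $ i * (adj E i j * x $ j)\<bar>" by simp
    also have "\<dots> = \<bar>x $ i\<bar> * (adj E i j * \<bar>x $ j\<bar>)" by (simp add: abs_mult adj_nonneg)
    finally show "x $ i * (adj E i j * x $ j) \<le> \<bar>x $ i\<bar> * (adj E i j * \<bar>x $ j\<bar>)" .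
  qed
  moreover have "abs_vec x \<bullet> abs_vec x = x \<bullet> x" by (simp add: abs_vec_def inner_vec_def)
  moreover have "x \<bullet> (?A *v x) = l * (x \<bullet> x)" by (simp add: ev)
  ultimately show "abs_vec x \<bullet> (?A *v abs_vec x) = l * (abs_vec x \<bullet> abs_vec x)"
    using le[of "abs_vec x"] by simp
qed auto

lemma abs_vec_eq_0: "abs_vec x = 0 \<longleftrightarrow> x = 0"
  by (simp add: abs_vec_def vec_eq_iff)

text \<open>
  The largest eigenvalue \<open>l\<close> is simple and has a positive unit eigenvector \<open>u\<close>; simplicity is expressed
  by the absence of further eigenvectors for \<open>l\<close> orthogonal to \<open>u\<close>.
\<close>

lemma perron_frobenius:
  assumes "symp E" and con: "connected_graph E"
  obtains u l where "norm u = 1" "\<And>i. u $ i > 0" "real_adjacency E *v u = l *\<^sub>R u"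
    "\<And>y. y \<bullet> (real_adjacency E *v y) \<le> l * (y \<bullet> y)"
    "\<And>v. real_adjacency E *v v = l *\<^sub>R v \<Longrightarrow> u \<bullet> v = 0 \<Longrightarrow> v = 0"
proof -
  let ?A = "real_adjacency E"
  have "\<exists>y\<in>UNIV. (y :: real ^ 'a) \<noteq> 0" by (metis UNIV_I axis_eq_0_iff zero_neq_one)
  from symmetric_exists_top_eigenvector[OF transpose_real_adjacency[OF assms(1)] subspace_UNIV this]
  obtain x l where x: "x \<noteq> 0" "?A *v x = l *\<^sub>R x" and le: "\<And>y. y \<bullet> (?A *v y) \<le> l * (y \<bullet> y)"
    by (metis UNIV_I)
  have absev: "?A *v abs_vec v = l *\<^sub>R abs_vec v" if "?A *v v = l *\<^sub>R v" for v
    by (rule top_eigenvector_abs[OF assms(1) that le])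
  have pos: "abs_vec v $ i > 0" if "?A *v v = l *\<^sub>R v" "v \<noteq> 0" for v i
    by (rule nonneg_eigenvector_pos[OF con absev[OF that(1)]])
      (use that in \<open>auto simp: abs_vec_eq_0\<close>, simp add: abs_vec_def)
  define u where "u = (1 / norm x) *\<^sub>R abs_vec x"
  have nabs: "norm (abs_vec x) = norm x" by (simp add: abs_vec_def norm_vec_def L2_set_def)
  have upos: "u $ i > 0" for i using pos[OF x(2,1)] x(1) by (simp add: u_def)
  show ?thesis
  proof (rule that)
    show "norm u = 1" using x(1) by (simp add: u_def nabs)
    show "?A *v u = l *\<^sub>R u" by (simp add: u_def matrix_vector_mult_scaleR absev[OF x(2)])
    show "u $ i > 0" for i by (rule upos)
    fix v assume v: "?A *v v = l *\<^sub>R v" and uv: "u \<bullet> v = 0"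
    show "v = 0"
    proof (rule ccontr)
      assume v0: "v \<noteq> 0"
      have s0: "(\<Sum>i\<in>UNIV. u $ i * v $ i) = 0" using uv by (simp add: inner_vec_def)
      \<comment> \<open>\<open>w\<close> is a nonnegative eigenvector, so it is zero or positive; hence \<open>v\<close> has constant sign\<close>
      define w where "w = v + abs_vec v"
      have wev: "?A *v w = l *\<^sub>R w"
        by (simp add: w_def matrix_vector_right_distrib v absev[OF v] scaleR_right_distrib)
      have wi: "w $ i = v $ i + \<bar>v $ i\<bar>" for i by (simp add: w_def abs_vec_def)
      show False
      proof (cases "w = 0")
        case True
        then have "v $ i < 0" for i using wi[of i] pos[OF v v0, of i]
          by (auto simp: abs_vec_def)
        then have "(\<Sum>i\<in>UNIV. u $ i * - v $ i) > 0"
          using upos by (intro sum_pos mult_pos_pos) auto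
        then show False using s0 by (simp add: sum_negf)
      next
        case False
        have "w $ i > 0" for i
          by (rule nonneg_eigenvector_pos[OF con wev _ False]) (simp add: wi)
        then have "v $ i > 0" for i using wi[of i] by (metis abs_of_nonpos add.right_inverse less_irrefl not_le)
        then have "(\<Sum>i\<in>UNIV. u $ i * v $ i) > 0"
          using upos by (intro sum_pos) auto
        then show False using s0 by simp
      qed
    qed
  qed (rule le)
qed

text \<open>
  The complex eigenvalues are exactly the real ones: a complex eigenvalue is real by symmetry, and
  the real or the imaginary part of its eigenvector is a nonzero real eigenvector.
\<close>

lemma eigenvalues_adjacency:
  assumes "symp E"
  shows "eigenvalues (adjacency_matrix E) = of_real ` {k. \<exists>x. x \<noteq> 0 \<and> real_adjacency E *v x = k *\<^sub>R x}"
    (is "?L = of_real ` ?R")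
proof
  have sym: "E i j \<longleftrightarrow> E j i" for i j using assms by (auto dest: sympD)
  have mult: "(adjacency_matrix E *v x) $ i = (\<Sum>j\<in>UNIV. of_real (adj E i j) * x $ j)" for x i
    by (auto simp: adjacency_matrix_def matrix_vector_mult_def adj_def intro!: sum.cong)
  show "of_real ` ?R \<subseteq> ?L"
  proof (rule image_subsetI)
    fix k assume "k \<in> ?R"
    then obtain x where x: "x \<noteq> 0" "real_adjacency E *v x = k *\<^sub>R x" by auto
    let ?x = "\<chi> i. complex_of_real (x $ i)"
    have "(adjacency_matrix E *v ?x) $ i = (of_real k *s ?x) $ i" for i
      using arg_cong[OF x(2), of "\<lambda>v. complex_of_real (v $ i)"]
      by (simp add: mult real_adjacency_mult)
    moreover have "?x \<noteq> 0" using x(1) by (simp add: vec_eq_iff)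
    ultimately show "of_real k \<in> ?L"
      unfolding eigenvalues_def by (auto simp: vec_eq_iff intro!: exI[of _ ?x])
  qed
  show "?L \<subseteq> of_real ` ?R"
  proof
    fix k assume "k \<in> ?L"
    then obtain x where x: "x \<noteq> 0" and ev: "adjacency_matrix E *v x = k *s x"
      by (auto simp: eigenvalues_def)
    have evi: "(\<Sum>j\<in>UNIV. of_real (adj E i j) * x $ j) = k * x $ i" for i
      using arg_cong[OF ev, of "\<lambda>v. v $ i"] by (simp add: mult)
    \<comment> \<open>the Hermitian form of \<open>x\<close> is real, hence so is \<open>k\<close>\<close>
    define h where "h = (\<Sum>i\<in>UNIV. \<Sum>j\<in>UNIV. cnj (x $ i) * (of_real (adj E i j) * x $ j))"
    have "h = (\<Sum>i\<in>UNIV. cnj (x $ i) * (k * x $ i))"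
      unfolding h_def sum_distrib_left[symmetric] by (simp add: evi)
    also have "\<dots> = k * of_real (\<Sum>i\<in>UNIV. (cmod (x $ i))\<^sup>2)"
      by (simp add: sum_distrib_left complex_norm_square mult_ac del: of_real_power)
    finally have h: "h = k * of_real (\<Sum>i\<in>UNIV. (cmod (x $ i))\<^sup>2)" .
    have "cnj h = h"
    proof -
      have "cnj h = (\<Sum>i\<in>UNIV. \<Sum>j\<in>UNIV. cnj (x $ j) * (of_real (adj E j i) * x $ i))"
        by (simp add: h_def adj_def sym mult_ac)
      also have "\<dots> = h" unfolding h_def by (rule sum.swap)
      finally show ?thesis .
    qed
    moreover have nz: "(\<Sum>i\<in>UNIV. (cmod (x $ i))\<^sup>2) \<noteq> 0"
      using x by (subst sum_nonneg_eq_0_iff) (auto simp: vec_eq_iff)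
    ultimately have "cnj k = k"
      using h by (metis complex_cnj_complex_of_real complex_cnj_mult mult_right_cancel of_real_eq_0_iff)
    then have k: "k = of_real (Re k)" by (metis Reals_cnj_iff of_real_Re)
    let ?r = "\<chi> i. Re (x $ i)" and ?m = "\<chi> i. Im (x $ i)"
    have "real_adjacency E *v ?r = Re k *\<^sub>R ?r"
      using arg_cong[OF evi, of Re] by (subst vec_eq_iff) (subst (asm) k, simp add: real_adjacency_mult)
    moreover have "real_adjacency E *v ?m = Re k *\<^sub>R ?m"
      using arg_cong[OF evi, of Im] by (subst vec_eq_iff) (subst (asm) k, simp add: real_adjacency_mult)
    moreover have "?r \<noteq> 0 \<or> ?m \<noteq> 0" using x by (auto simp: vec_eq_iff complex_eq_iff)
    ultimately show "k \<in> of_real ` ?R" using k by blast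
  qed
qed

text \<open>
  The entrywise form of \<open>(B - s I)(B - t I) = \<alpha> \<alpha>\<^sup>T\<close>, where \<open>s\<close> and \<open>t\<close> are the two smaller eigenvalues,
  \<open>a = s + t\<close> and \<open>p = s * t\<close>.
\<close>

lemma rank_one_identity:
  assumes "in_G3 E"
  obtains a p :: real and \<alpha> where "\<And>x. \<alpha> x > 0"
    "\<And>x y. (\<Sum>w\<in>UNIV. adj E x w * adj E w y) = \<alpha> x * \<alpha> y + a * adj E x y - p * of_bool (x = y)"
proof -
  let ?A = "real_adjacency E"
  have symE: "symp E" and con: "connected_graph E" and c3: "card (eigenvalues (adjacency_matrix E)) = 3"
    using assms by (auto simp: in_G3_def simple_graph_def)
  note tr = transpose_real_adjacency[OF symE]
  have symA: "y \<bullet> (?A *v x) = (?A *v y) \<bullet> x" for x y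
    using tr by (metis dot_lmul_matrix transpose_matrix_vector)
  define R where "R = {k. \<exists>x. x \<noteq> 0 \<and> ?A *v x = k *\<^sub>R x}"
  have cR: "card R = 3"
    using c3 unfolding eigenvalues_adjacency[OF symE] R_def by (simp add: card_image inj_on_def)
  obtain u l where u: "norm u = 1" "\<And>i. u $ i > 0" "?A *v u = l *\<^sub>R u"
    and le: "\<And>y. y \<bullet> (?A *v y) \<le> l * (y \<bullet> y)"
    and simple: "\<And>v. ?A *v v = l *\<^sub>R v \<Longrightarrow> u \<bullet> v = 0 \<Longrightarrow> v = 0"
    by (rule perron_frobenius[OF symE con], rule that)
  have uu: "u \<bullet> u = 1" using u(1) by (simp add: dot_square_norm)
  then have u0: "u \<noteq> 0" by auto
  have "l \<in> R" using u u0 by (auto simp: R_def)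
  then have "card (R - {l}) = 2" using cR by simp
  then obtain s t where st: "R - {l} = {s, t}" by (auto simp: card_2_iff)
  have less: "k < l" if "k \<in> {s, t}" for k
  proof -
    have "k \<in> R" "k \<noteq> l" using that st by auto
    then obtain x where x: "x \<noteq> 0" "?A *v x = k *\<^sub>R x" by (auto simp: R_def)
    have "k * (x \<bullet> x) \<le> l * (x \<bullet> x)" using le[of x] x by simp
    then show ?thesis using x(1) \<open>k \<noteq> l\<close> by (simp add: mult_le_cancel_right not_less)
  qed
  define M where "M v = ?A *v (?A *v v) - (s + t) *\<^sub>R (?A *v v) + (s * t) *\<^sub>R v" for v
  have lin: "linear M"
    unfolding M_def by (intro linearI) (simp_all add: matrix_vector_right_distrib
      matrix_vector_mult_scaleR algebra_simps)
  have Mev: "M x = ((k - s) * (k - t)) *\<^sub>R x" if "?A *v x = k *\<^sub>R x" for x k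
    using that by (simp add: M_def matrix_vector_mult_scaleR algebra_simps)
  have Msym: "M x \<bullet> y = x \<bullet> M y" for x y
    unfolding M_def by (simp add: inner_add_left inner_add_right inner_diff_left inner_diff_right symA)
  have AM: "?A *v M v = M (?A *v v)" for v
    by (simp add: M_def matrix_vector_right_distrib matrix_vector_mult_diff_distrib
        matrix_vector_mult_scaleR)
  define P where "P = {v. u \<bullet> v = 0}"
  have P: "subspace P" unfolding P_def by (rule subspace_hyperplane)
  have AP: "?A *v v \<in> P" if "v \<in> P" for v using that by (simp add: P_def symA u)
  \<comment> \<open>otherwise the image of the complement of \<open>u\<close> under \<open>M\<close> contains an eigenvector \<open>M y\<close>; its
    eigenvalue is \<open>s\<close> or \<open>t\<close>, so \<open>M\<close> kills it, and it is orthogonal to itself\<close>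
  have kill: "M v = 0" if v: "v \<in> P" for v
  proof (rule ccontr)
    assume nz: "M v \<noteq> 0"
    have "subspace (M ` P)" by (rule linear_subspace_image[OF lin P])
    moreover have "\<exists>y\<in>M ` P. y \<noteq> 0" using v nz by blast
    moreover have "?A *v y \<in> M ` P" if "y \<in> M ` P" for y using that AP by (auto simp: AM)
    ultimately obtain k x where x: "x \<in> M ` P" "x \<noteq> 0" "?A *v x = k *\<^sub>R x"
      using symmetric_exists_top_eigenvector[OF tr] by metis
    then obtain y where y: "y \<in> P" "x = M y" by auto
    have "u \<bullet> x = 0" using y Mev[OF u(3)] by (simp add: P_def Msym[symmetric])
    then have "k \<noteq> l" using x simple by blast
    moreover have "k \<in> R" using x by (auto simp: R_def)
    ultimately have "k \<in> {s, t}" using st by blast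
    then have "M x = 0" using Mev[OF x(3)] by auto
    then have "x \<bullet> x = 0" using Msym[of x y] y by simp
    then show False using x by simp
  qed
  define c where "c = (l - s) * (l - t)"
  have c: "c > 0" using less by (simp add: c_def)
  have Mall: "M v = (c * (u \<bullet> v)) *\<^sub>R u" for v
  proof -
    have "v - (u \<bullet> v) *\<^sub>R u \<in> P" by (simp add: P_def inner_diff_right uu)
    from kill[OF this] have "M v = (u \<bullet> v) *\<^sub>R M u"
      by (simp add: linear_diff[OF lin] linear_scale[OF lin])
    then show ?thesis using Mev[OF u(3)] by (simp add: c_def)
  qed
  show ?thesis
  proof (rule that[of "\<lambda>x. sqrt c * u $ x" "s + t" "s * t"])
    show "sqrt c * u $ x > 0" for x using u(2) c by simp
    fix x y
    have A1: "(?A *v axis y 1) $ w = adj E w y" for w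
      by (simp add: matrix_vector_mul_component inner_axis real_adjacency_def row_def)
    have "M (axis y 1) $ x = (\<Sum>w\<in>UNIV. adj E x w * adj E w y) - (s + t) * adj E x y + s * t * of_bool (x = y)"
      unfolding M_def vector_add_component vector_minus_component vector_scaleR_component
        real_adjacency_mult[of E "?A *v axis y 1"] A1 by (simp add: axis_def)
    moreover have "M (axis y 1) $ x = (sqrt c * u $ x) * (sqrt c * u $ y)"
      unfolding Mall using c by (simp add: inner_axis mult_ac)
    ultimately show "(\<Sum>w\<in>UNIV. adj E x w * adj E w y)
      = (sqrt c * u $ x) * (sqrt c * u $ y) + (s + t) * adj E x y - s * t * of_bool (x = y)" by simp
  qed
qed

section \<open>The quotient of an equitable degree partition\<close>

text \<open>
  A connected graph satisfying the rank-one identity, in which \<open>\<alpha>\<close> has exactly the values \<open>s1\<close>, \<open>s2\<close>,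
  \<open>s3\<close> and the partition into the cells \<open>{w. \<alpha> w = s}\<close> is equitable. Cells are named by their value
  of \<open>\<alpha>\<close>. The conditions are symmetric in \<open>s1\<close>, \<open>s2\<close>, \<open>s3\<close>, so results about particular cells hold for
  every permutation of them.
\<close>

locale three_cells =
  fixes E :: "'v::finite \<Rightarrow> 'v \<Rightarrow> bool" and \<alpha> :: "'v \<Rightarrow> real" and a p s1 s2 s3 :: real
  assumes symE: "symp E" and irrE: "irreflp E" and con: "connected_graph E"
    and pos: "\<alpha> x > 0"
    and sq: "(\<Sum>w\<in>UNIV. adj E x w * adj E w y) = \<alpha> x * \<alpha> y + a * adj E x y - p * of_bool (x = y)"
    and cells: "range \<alpha> = {s1, s2, s3}" and distinct: "s1 \<noteq> s2" "s1 \<noteq> s3" "s2 \<noteq> s3"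
    and equit: "\<alpha> x = \<alpha> y \<Longrightarrow>
      (\<Sum>w\<in>UNIV. adj E x w * of_bool (\<alpha> w = s)) = (\<Sum>w\<in>UNIV. adj E y w * of_bool (\<alpha> w = s))"
begin

lemma three_cells_swap12: "three_cells E \<alpha> a p s2 s1 s3"
  by (rule three_cells.intro)
    (rule symE irrE con pos sq distinct distinct[symmetric] | erule equit | simp add: cells insert_commute)+

lemma three_cells_swap23: "three_cells E \<alpha> a p s1 s3 s2"
  by (rule three_cells.intro)
    (rule symE irrE con pos sq distinct distinct[symmetric] | erule equit | simp add: cells insert_commute)+

text \<open>
  The number of vertices of a cell, as a real number.
\<close>

definition n :: "real \<Rightarrow> real" where
  "n s = (\<Sum>w\<in>UNIV. of_bool (\<alpha> w = s))"

text \<open>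
  The entry of the quotient matrix: the number of neighbours in cell \<open>t\<close> of a vertex of cell \<open>s\<close>. By
  equitability the choice of the vertex does not matter.
\<close>

definition K :: "real \<Rightarrow> real \<Rightarrow> real" where
  "K s t = (\<Sum>w\<in>UNIV. adj E (SOME x. \<alpha> x = s) w * of_bool (\<alpha> w = t))"

lemma adj_commute: "adj E x y = adj E y x"
  using symE by (auto simp: adj_def dest: sympD)

lemma adj_self: "adj E x x = 0"
  using irrE by (auto simp: adj_def dest: irreflpD)

lemma K_eq:
  assumes "\<alpha> x = s"
  shows "(\<Sum>w\<in>UNIV. adj E x w * of_bool (\<alpha> w = t)) = K s t"
  unfolding K_def by (rule equit) (use assms in \<open>auto intro: someI2[of _ x]\<close>)

lemma n_card: "n s = real (card {w. \<alpha> w = s})"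
  by (simp add: n_def of_bool_def sum.If_cases)

lemma cell_rep:
  assumes "s \<in> {s1, s2, s3}"
  obtains x where "\<alpha> x = s"
  using assms cells by (metis imageE)

lemma cell_pos: "s \<in> {s1, s2, s3} \<Longrightarrow> s > 0"
  using pos cells by (metis imageE)

lemma n_ge_1:
  assumes "s \<in> {s1, s2, s3}"
  shows "n s \<ge> 1"
proof -
  obtain x where "\<alpha> x = s" using cell_rep[OF assms] .
  then have "card {w. \<alpha> w = s} \<noteq> 0" by (auto simp: card_eq_0_iff)
  then have "1 \<le> card {w. \<alpha> w = s}" by linarith
  then show ?thesis by (simp add: n_card)
qed

lemma K_nonneg: "K s t \<ge> 0"
  unfolding K_def by (intro sum_nonneg) (simp add: adj_def)

lemma K_le: "K s t \<le> n t"
  unfolding K_def n_def by (intro sum_mono) (simp add: adj_def)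

lemma K_Ints: "K s t \<in> \<int>"
  unfolding K_def by (intro Ints_sum) (simp add: adj_def)

lemma n_Ints: "n t \<in> \<int>"
  unfolding n_def by (intro Ints_sum) simp

lemma K_self_le:
  assumes "s \<in> {s1, s2, s3}"
  shows "K s s \<le> n s - 1"
proof -
  obtain x where x: "\<alpha> x = s" using cell_rep[OF assms] .
  have "K s s \<le> (\<Sum>w\<in>UNIV. of_bool (\<alpha> w = s) - of_bool (w = x))"
    unfolding K_eq[OF x, symmetric] using x irrE
    by (intro sum_mono) (auto simp: adj_def dest: irreflpD)
  also have "\<dots> = n s - 1" by (simp add: n_def sum_subtractf of_bool_def)
  finally show ?thesis .
qed

lemma sum_cells:
  "(\<Sum>w\<in>UNIV. g w) = (\<Sum>w\<in>UNIV. g w * of_bool (\<alpha> w = s1)) + (\<Sum>w\<in>UNIV. g w * of_bool (\<alpha> w = s2))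
    + (\<Sum>w\<in>UNIV. g w * (of_bool (\<alpha> w = s3) :: real))"
proof -
  have "g w = g w * of_bool (\<alpha> w = s1) + g w * of_bool (\<alpha> w = s2) + g w * of_bool (\<alpha> w = s3)" for w
    using cells distinct by (cases "\<alpha> w = s1"; cases "\<alpha> w = s2"; cases "\<alpha> w = s3") auto
  then show ?thesis by (subst sum.distrib[symmetric])+ (rule sum.cong, auto)
qed

lemma degree_eq:
  assumes "s \<in> {s1, s2, s3}"
  shows "K s s1 + K s s2 + K s s3 = s * s - p"
proof -
  obtain x where x: "\<alpha> x = s" using cell_rep[OF assms] .
  have "adj E x w * adj E w x = adj E x w" for w
    by (subst adj_commute[of w]) (simp add: adj_def)
  then have "(\<Sum>w\<in>UNIV. adj E x w) = s * s - p"
    using sq[of x x] x by (simp only: adj_self) simp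
  then show ?thesis using sum_cells[of "adj E x"] by (simp add: K_eq[OF x])
qed

lemma double_count: "n s * K s t = n t * K t s"
proof -
  have *: "(\<Sum>x\<in>UNIV. of_bool (\<alpha> x = s) * (\<Sum>y\<in>UNIV. adj E x y * of_bool (\<alpha> y = t))) = n s * K s t" for s t
    unfolding n_def sum_distrib_right by (rule sum.cong) (auto simp: K_eq simp del: sum_mult_of_bool_eq)
  have "n s * K s t = (\<Sum>x\<in>UNIV. \<Sum>y\<in>UNIV. of_bool (\<alpha> x = s) * (adj E x y * of_bool (\<alpha> y = t)))"
    unfolding *[symmetric] sum_distrib_left ..
  also have "\<dots> = (\<Sum>y\<in>UNIV. \<Sum>x\<in>UNIV. of_bool (\<alpha> x = s) * (adj E x y * of_bool (\<alpha> y = t)))"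
    by (rule sum.swap)
  also have "\<dots> = n t * K t s"
    unfolding *[symmetric] sum_distrib_left by (simp add: adj_commute mult_ac)
  finally show ?thesis .
qed

text \<open>
  The rank-one identity, with its column index summed over the cell \<open>t\<close>.
\<close>

lemma quotient_eq:
  assumes "s \<in> {s1, s2, s3}" "t \<in> {s1, s2, s3}"
  shows "K s s1 * K s1 t + K s s2 * K s2 t + K s s3 * K s3 t
    = s * t * n t + a * K s t - p * of_bool (s = t)"
proof -
  obtain x where x: "\<alpha> x = s" using cell_rep[OF assms(1)] .
  have c: "(\<Sum>w\<in>UNIV. adj E x w * K (\<alpha> w) t * of_bool (\<alpha> w = r)) = K s r * K r t" for r
    unfolding K_eq[OF x, of r, symmetric] sum_distrib_right by (rule sum.cong) auto
  have "(\<Sum>y\<in>UNIV. of_bool (\<alpha> y = t) * (\<Sum>w\<in>UNIV. adj E x w * adj E w y))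
      = (\<Sum>w\<in>UNIV. adj E x w * (\<Sum>y\<in>UNIV. adj E w y * of_bool (\<alpha> y = t)))"
    unfolding sum_distrib_left by (subst sum.swap) (simp add: mult_ac)
  also have "\<dots> = (\<Sum>w\<in>UNIV. adj E x w * K (\<alpha> w) t)" by (simp add: K_eq del: sum_mult_of_bool_eq)
  also have "\<dots> = K s s1 * K s1 t + K s s2 * K s2 t + K s s3 * K s3 t"
    by (subst sum_cells) (simp only: c)
  finally have "K s s1 * K s1 t + K s s2 * K s2 t + K s s3 * K s3 t
      = (\<Sum>y\<in>UNIV. of_bool (\<alpha> y = t) * (\<alpha> x * \<alpha> y + a * adj E x y - p * of_bool (x = y)))"
    by (simp only: sq)
  also have "\<dots> = (\<Sum>y\<in>UNIV. s * t * of_bool (\<alpha> y = t) + a * (adj E x y * of_bool (\<alpha> y = t))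
      - p * of_bool (s = t) * of_bool (y = x))"
    by (rule sum.cong) (auto simp: x algebra_simps)
  also have "\<dots> = s * t * n t + a * K s t - p * of_bool (s = t)"
    unfolding K_eq[OF x, symmetric] n_def sum_distrib_left
    by (simp add: sum.distrib sum_subtractf sum_distrib_left[symmetric] of_bool_def)
  finally show ?thesis .
qed

text \<open>
  For distinct cells the entries \<open>0\<close> and \<open>n t\<close> of the quotient matrix mean that the two cells are
  not joined at all, or completely joined.
\<close>

lemma K_zero_iff:
  assumes "\<alpha> x = s"
  shows "K s t = 0 \<longleftrightarrow> (\<forall>y. \<alpha> y = t \<longrightarrow> \<not> E x y)"
  by (subst K_eq[OF assms, symmetric], subst sum_nonneg_eq_0_iff) (auto simp: adj_def)

lemma K_full_iff:
  assumes "\<alpha> x = s"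
  shows "K s t = n t \<longleftrightarrow> (\<forall>y. \<alpha> y = t \<longrightarrow> E x y)"
proof -
  have "n t - K s t = (\<Sum>w\<in>UNIV. of_bool (\<alpha> w = t) * (1 - adj E x w))"
    by (simp add: K_eq[OF assms, symmetric] n_def sum_subtractf algebra_simps)
  then have "K s t = n t \<longleftrightarrow> (\<Sum>w\<in>UNIV. of_bool (\<alpha> w = t) * (1 - adj E x w)) = 0" by linarith
  also have "\<dots> \<longleftrightarrow> (\<forall>y. \<alpha> y = t \<longrightarrow> E x y)"
    by (subst sum_nonneg_eq_0_iff) (auto simp: adj_def)
  finally show ?thesis .
qed

lemma full_sym: "s \<in> {s1, s2, s3} \<Longrightarrow> t \<in> {s1, s2, s3} \<Longrightarrow> K s t = n t \<longleftrightarrow> K t s = n s"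
  using double_count[of s t] n_ge_1[of s] n_ge_1[of t] by (auto simp: mult.commute)

lemma zero_sym: "s \<in> {s1, s2, s3} \<Longrightarrow> t \<in> {s1, s2, s3} \<Longrightarrow> K s t = 0 \<longleftrightarrow> K t s = 0"
  using double_count[of s t] n_ge_1[of s] n_ge_1[of t] by auto

end

section \<open>Cells joined completely or not at all\<close>

context three_cells
begin

text \<open>
  All three cells pairwise completely joined. Comparing the degrees of two vertices in different
  cells with the number of their common neighbours shows that \<open>s * s + t * t - s * t\<close> is the same number for
  all three pairs of values.
\<close>

lemma triangle_False:
  assumes "K s1 s2 = n s2" "K s1 s3 = n s3" "K s2 s3 = n s3"
  shows False
proof -
  have n: "n s1 > 0" "n s2 > 0" "n s3 > 0" using n_ge_1[of s1] n_ge_1[of s2] n_ge_1[of s3] by auto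
  have K: "K s2 s1 = n s1" "K s3 s1 = n s1" "K s3 s2 = n s2"
    using assms full_sym by auto
  have q12: "K s1 s1 + K s2 s2 + n s3 = s1 * s2 + a"
  proof -
    have "n s2 * (K s1 s1 + K s2 s2 + n s3) = n s2 * (s1 * s2 + a)"
      using quotient_eq[of s1 s2] distinct by (simp add: assms K algebra_simps)
    then show ?thesis using n by simp
  qed
  have q13: "K s1 s1 + K s3 s3 + n s2 = s1 * s3 + a"
  proof -
    have "n s3 * (K s1 s1 + K s3 s3 + n s2) = n s3 * (s1 * s3 + a)"
      using quotient_eq[of s1 s3] distinct by (simp add: assms K algebra_simps)
    then show ?thesis using n by simp
  qed
  have q23: "K s2 s2 + K s3 s3 + n s1 = s2 * s3 + a"
  proof -
    have "n s3 * (K s2 s2 + K s3 s3 + n s1) = n s3 * (s2 * s3 + a)"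
      using quotient_eq[of s2 s3] distinct by (simp add: assms K algebra_simps)
    then show ?thesis using n by simp
  qed
  note d = degree_eq[of s1] degree_eq[of s2] degree_eq[of s3]
  have d1: "K s1 s1 + n s2 + n s3 = s1 * s1 - p" and d2: "n s1 + K s2 s2 + n s3 = s2 * s2 - p"
    and d3: "n s1 + n s2 + K s3 s3 = s3 * s3 - p"
    using d by (simp_all add: assms K)
  have "(s1 - s3) * (s1 + s3 - s2) = 0"
    using q12 q23 d1 d2 d3 by (simp add: algebra_simps)
  then have "s2 = s1 + s3" using distinct by auto
  moreover have "(s1 - s2) * (s1 + s2 - s3) = 0"
    using q13 q23 d1 d2 d3 by (simp add: algebra_simps)
  then have "s3 = s1 + s2" using distinct by auto
  ultimately show False using cell_pos[of s1] by auto
qed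

text \<open>
  Cells joined along the path \<open>s1\<close>, \<open>s2\<close>, \<open>s3\<close>, where \<open>s3\<close> is the smaller of the two end values. A
  vertex of one end cell and a vertex of the other have \<open>n s2 = s1 * s3\<close> common neighbours. Two
  nonadjacent vertices of the cell \<open>s3\<close> would have at least as many, but they can only have \<open>s3 * s3\<close>.
  So this cell is complete, and it turns out to be a single vertex. Then
  \<open>K s2 s2 * s3\<^sup>2 = p * (n s2 - 1)\<close> with \<open>p < 0\<close>, so the cell \<open>s2\<close> is a single vertex too, and \<open>s3 * s3\<close>
  becomes an integer below \<open>s1 * s3 = 1\<close>.
\<close>

lemma path_False_aux:
  assumes K12: "K s1 s2 = n s2" and K23: "K s2 s3 = n s3" and K13: "K s1 s3 = 0" and gt: "s1 > s3"
  shows False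
proof -
  have n: "n s1 \<ge> 1" "n s2 \<ge> 1" "n s3 \<ge> 1" using n_ge_1[of s1] n_ge_1[of s2] n_ge_1[of s3] by auto
  have s: "s1 > 0" "s2 > 0" "s3 > 0" using cell_pos by auto
  have K: "K s2 s1 = n s1" "K s3 s2 = n s2" "K s3 s1 = 0"
    using assms full_sym[of s1 s2] full_sym[of s2 s3] zero_sym[of s1 s3] by auto
  note K = K K12 K23 K13
  have d1: "K s1 s1 + n s2 = s1 * s1 - p" and d2: "n s1 + K s2 s2 + n s3 = s2 * s2 - p"
    and d3: "n s2 + K s3 s3 = s3 * s3 - p"
    using degree_eq[of s1] degree_eq[of s2] degree_eq[of s3] by (simp_all add: K)
  have q13: "n s2 = s1 * s3"
  proof -
    have "n s3 * n s2 = n s3 * (s1 * s3)"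
      using quotient_eq[of s1 s3] distinct by (simp add: K algebra_simps)
    then show ?thesis using n by simp
  qed
  have q12: "K s1 s1 + K s2 s2 = s1 * s2 + a"
  proof -
    have "n s2 * (K s1 s1 + K s2 s2) = n s2 * (s1 * s2 + a)"
      using quotient_eq[of s1 s2] distinct by (simp add: K algebra_simps)
    then show ?thesis using n by simp
  qed
  have q23: "K s2 s2 + K s3 s3 = s2 * s3 + a"
  proof -
    have "n s3 * (K s2 s2 + K s3 s3) = n s3 * (s2 * s3 + a)"
      using quotient_eq[of s2 s3] distinct by (simp add: K algebra_simps)
    then show ?thesis using n by simp
  qed
  have "(s1 - s3) * (s1 + s3 - s2) = 0"
    using q12 q23 d1 d3 by (simp add: algebra_simps)
  then have s2: "s2 = s1 + s3" using distinct by auto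
  have K22: "K s2 s2 = a + p + 2 * n s2"
    using q12 d1 q13 by (simp add: s2 algebra_simps)
  have n2: "s3 * s3 < n s2" using gt s q13 by (simp add: mult_strict_right_mono)
  have E3: "E x y" if "\<alpha> x = s3" "\<alpha> y = s3" "x \<noteq> y" for x y
  proof (rule ccontr)
    assume "\<not> E x y"
    then have "(\<Sum>w\<in>UNIV. adj E x w * adj E w y) = s3 * s3" using that by (simp add: sq) (simp add: adj_def)
    moreover have "n s2 \<le> (\<Sum>w\<in>UNIV. adj E x w * adj E w y)"
      unfolding n_def
    proof (rule sum_mono)
      fix w
      have "E x w" "E w y" if "\<alpha> w = s2"
        using K_full_iff[of x s3 s2] K_full_iff[of w s2 s3] K \<open>\<alpha> x = s3\<close> \<open>\<alpha> y = s3\<close> that by auto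
      then show "of_bool (\<alpha> w = s2) \<le> adj E x w * adj E w y" by (auto simp: adj_def)
    qed
    ultimately show False using n2 by simp
  qed
  have K33: "K s3 s3 = n s3 - 1"
  proof -
    obtain x where x: "\<alpha> x = s3" using cell_rep[of s3] by auto
    have "K s3 s3 = (\<Sum>w\<in>UNIV. of_bool (\<alpha> w = s3) - of_bool (w = x))"
      unfolding K_eq[OF x, symmetric] using x irrE E3[OF x]
      by (intro sum.cong) (auto simp: adj_def dest: irreflpD)
    then show ?thesis by (simp add: n_def sum_subtractf of_bool_def)
  qed
  have "n s3 = 1"
  proof -
    have "(n s3 - 1) * (n s3 - 1) + n s2 * n s3 = s3 * s3 * n s3 + a * (n s3 - 1) - p"
      using quotient_eq[of s3 s3] by (simp add: K K33)
    moreover have "n s3 * (n s2 + (n s3 - 1)) = n s3 * (s3 * s3 - p)" using d3 by (simp add: K33)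
    ultimately have "(n s3 - 1) * (a + p + 1) = 0" by (simp add: algebra_simps)
    moreover have "a + p + 1 \<noteq> 0" using K22 K_self_le[of s2] n by auto
    ultimately show ?thesis by simp
  qed
  note K33 = K33[unfolded this, simplified]
  have p: "p = s3 * s3 - n s2" using d3 K33 by simp
  have q22: "n s1 * n s2 + K s2 s2 * K s2 s2 + n s2 = s2 * s2 * n s2 + a * K s2 s2 - p"
    using quotient_eq[of s2 s2] by (simp add: K \<open>n s3 = 1\<close> algebra_simps)
  have a: "a = K s2 s2 - p - 2 * n s2" and n1: "n s1 = s2 * s2 - p - K s2 s2 - 1"
    using K22 d2 \<open>n s3 = 1\<close> by auto
  have eq: "K s2 s2 * (s3 * s3) = p * (n s2 - 1)"
    using q22 unfolding a n1 p by (simp add: algebra_simps)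
  have p0: "p < 0" using p n2 by simp
  have "K s2 s2 * (s3 * s3) \<ge> 0" using K_nonneg by simp
  moreover have "p * (n s2 - 1) \<le> 0" using p0 n by (intro mult_nonpos_nonneg) auto
  ultimately have "p * (n s2 - 1) = 0" "K s2 s2 * (s3 * s3) = 0" using eq by auto
  then have "n s2 = 1" "K s2 s2 = 0" using p0 s by auto
  then have s13: "s1 * s3 = 1" using q13 by simp
  have "s3 * s3 = n s1 - K s1 s1 - 2"
    using n1 d1 p s13 \<open>n s2 = 1\<close> \<open>K s2 s2 = 0\<close> by (simp add: s2 algebra_simps)
  then have "s3 * s3 \<in> \<int>" using K_Ints n_Ints by simp
  moreover have "s3 * s3 > 0" "s3 * s3 < 1" using s n2 \<open>n s2 = 1\<close> by auto
  ultimately show False by (metis Ints_cases of_int_0_less_iff of_int_less_1_iff zless_imp_add1_zle add_0 not_le)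
qed

lemma path_False:
  assumes K12: "K s1 s2 = n s2" and K23: "K s2 s3 = n s3" and K13: "K s1 s3 = 0"
  shows False
proof (cases "s1 > s3")
  case True
  then show False using path_False_aux assms by blast
next
  case False
  interpret r: three_cells E \<alpha> a p s3 s2 s1
    by (rule three_cells.intro)
    (rule symE irrE con pos sq distinct distinct[symmetric] | erule equit | simp add: cells insert_commute)+
  show False
    by (rule r.path_False_aux)
      (use False distinct assms full_sym[of s1 s2] full_sym[of s2 s3] zero_sym[of s1 s3] in auto)
qed

lemma isolated_False:
  assumes "K s1 s2 = 0" "K s1 s3 = 0"
  shows False
proof -
  obtain x y where x: "\<alpha> x = s1" and y: "\<alpha> y = s2" using cell_rep by (metis insertI1 insertI2)
  have "\<alpha> v = s1" if "\<alpha> u = s1" "E u v" for u v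
    using that assms K_zero_iff[of u s1] cells by (metis rangeI insertE singletonD)
  then have "\<alpha> y = s1" using connected_propagate[OF con, of "\<lambda>u. \<alpha> u = s1"] x by blast
  then show False using y distinct by simp
qed

lemma uniform_False:
  assumes 12: "K s1 s2 = 0 \<or> K s1 s2 = n s2" and 13: "K s1 s3 = 0 \<or> K s1 s3 = n s3"
    and 23: "K s2 s3 = 0 \<or> K s2 s3 = n s3"
  shows False
proof -
  interpret p213: three_cells E \<alpha> a p s2 s1 s3 by (rule three_cells_swap12)
  interpret p132: three_cells E \<alpha> a p s1 s3 s2 by (rule three_cells_swap23)
  interpret p312: three_cells E \<alpha> a p s3 s1 s2 by (rule p132.three_cells_swap12)
  note sym = full_sym[of s1 s2] full_sym[of s1 s3] full_sym[of s2 s3]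
    zero_sym[of s1 s2] zero_sym[of s1 s3] zero_sym[of s2 s3]
  note F = path_False p213.path_False p132.path_False
    isolated_False p213.isolated_False p312.isolated_False triangle_False
  show False using assms sym F by auto
qed

end

section \<open>Two partially joined cells\<close>

context three_cells
begin

text \<open>
  Cells \<open>s1\<close> and \<open>s2\<close> joined partially, each of them complete or empty (\<open>e1\<close>, \<open>e2\<close> being \<open>1\<close> or \<open>0\<close>),
  and a third cell with a single vertex. Comparing an adjacent and a nonadjacent pair between the
  cells gives \<open>a\<close>. The bipartite graph between the cells is a design whose order \<open>r\<close> is the same from
  both sides, which makes the cells equally large.
\<close>

lemma mixed_sizes:
  assumes mixed: "K s1 s2 \<noteq> 0" "K s1 s2 \<noteq> n s2"
    and e: "e1 \<in> {0, 1}" "e2 \<in> {0, 1}"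
    and V1: "\<forall>x y. \<alpha> x = s1 \<longrightarrow> \<alpha> y = s1 \<longrightarrow> adj E x y = e1 * of_bool (x \<noteq> y)"
    and V2: "\<forall>x y. \<alpha> x = s2 \<longrightarrow> \<alpha> y = s2 \<longrightarrow> adj E x y = e2 * of_bool (x \<noteq> y)"
    and n3: "n s3 = 1"
  shows "a = - (e1 + e2)" "e1 * K s2 s1 + e2 * K s1 s2 + K s1 s3 * K s2 s3 = s1 * s2"
    "n s1 = n s2" "K s1 s2 = K s2 s1" "K s1 s1 = e1 * (n s1 - 1)" "K s2 s2 = e2 * (n s2 - 1)"
proof -
  have n: "n s1 \<ge> 1" "n s2 \<ge> 1" using n_ge_1[of s1] n_ge_1[of s2] by auto
  have "card {w. \<alpha> w = s3} = 1" using n3 by (simp add: n_card)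
  then obtain z where z: "{w. \<alpha> w = s3} = {z}" by (auto simp: card_1_singleton_iff)
  then have z': "\<alpha> w = s3 \<longleftrightarrow> w = z" for w by blast
  have Kz: "K s s3 = adj E x z" if "\<alpha> x = s" for x s
    by (subst K_eq[OF that, symmetric]) (simp add: z')
  have cross: "e1 * (K s2 s1 - adj E x y) + e2 * (K s1 s2 - adj E x y) + K s1 s3 * K s2 s3
      = s1 * s2 + a * adj E x y" if x: "\<alpha> x = s1" and y: "\<alpha> y = s2" for x y
  proof -
    have "(\<Sum>w\<in>UNIV. adj E x w * adj E w y * of_bool (\<alpha> w = s1))
        = (\<Sum>w\<in>UNIV. e1 * (adj E y w * of_bool (\<alpha> w = s1)) - e1 * adj E x y * of_bool (w = x))"
      by (rule sum.cong) (auto simp: V1 x adj_commute[of y])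
    also have "\<dots> = e1 * (K s2 s1 - adj E x y)"
      unfolding K_eq[OF y, symmetric]
      by (simp add: sum_subtractf sum_distrib_left[symmetric] of_bool_def right_diff_distrib)
    finally have 1: "(\<Sum>w\<in>UNIV. adj E x w * adj E w y * of_bool (\<alpha> w = s1)) = e1 * (K s2 s1 - adj E x y)" .
    have "(\<Sum>w\<in>UNIV. adj E x w * adj E w y * of_bool (\<alpha> w = s2))
        = (\<Sum>w\<in>UNIV. e2 * (adj E x w * of_bool (\<alpha> w = s2)) - e2 * adj E x y * of_bool (w = y))"
      by (rule sum.cong) (auto simp: V2 y)
    also have "\<dots> = e2 * (K s1 s2 - adj E x y)"
      unfolding K_eq[OF x, symmetric]
      by (simp add: sum_subtractf sum_distrib_left[symmetric] of_bool_def right_diff_distrib)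
    finally have 2: "(\<Sum>w\<in>UNIV. adj E x w * adj E w y * of_bool (\<alpha> w = s2)) = e2 * (K s1 s2 - adj E x y)" .
    have 3: "(\<Sum>w\<in>UNIV. adj E x w * adj E w y * of_bool (\<alpha> w = s3)) = K s1 s3 * K s2 s3"
      by (simp add: z' Kz[OF x] Kz[OF y] adj_commute[of z])
    have "x \<noteq> y" using x y distinct by auto
    then show ?thesis using sq[of x y] x y by (subst (asm) sum_cells) (simp add: 1 2 3)
  qed
  obtain x where x: "\<alpha> x = s1" using cell_rep[of s1] by auto
  obtain y where y: "\<alpha> y = s2" "adj E x y = 1"
    using mixed(1) K_zero_iff[OF x, of s2] by (auto simp: adj_def)
  obtain y' where y': "\<alpha> y' = s2" "adj E x y' = 0"
    using mixed(2) K_full_iff[OF x, of s2] by (auto simp: adj_def)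
  show a: "a = - (e1 + e2)" using cross[OF x y(1)] cross[OF x y'(1)] y(2) y'(2) by (simp add: algebra_simps)
  show "e1 * K s2 s1 + e2 * K s1 s2 + K s1 s3 * K s2 s3 = s1 * s2"
    using cross[OF x y'(1)] y'(2) by simp
  have KV: "K s s = e * (n s - 1)" if s: "s \<in> {s1, s2, s3}"
    and V: "\<And>x y. \<alpha> x = s \<Longrightarrow> \<alpha> y = s \<Longrightarrow> adj E x y = e * of_bool (x \<noteq> y)" for s e
  proof -
    obtain x where x: "\<alpha> x = s" using cell_rep[OF s] .
    have "K s s = (\<Sum>w\<in>UNIV. e * of_bool (\<alpha> w = s) - e * of_bool (w = x))"
      unfolding K_eq[OF x, symmetric] by (rule sum.cong) (auto simp: V[OF x] x)
    then show ?thesis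
      by (simp add: n_def sum_subtractf sum_distrib_left[symmetric] right_diff_distrib of_bool_def)
  qed
  show K11: "K s1 s1 = e1 * (n s1 - 1)" by (rule KV) (use V1 in auto)
  show K22: "K s2 s2 = e2 * (n s2 - 1)" by (rule KV) (use V2 in auto)
  have dc: "n s1 * K s1 s2 = n s2 * K s2 s1" by (rule double_count)
  have K31: "K s3 s1 = n s1 * K s1 s3" "K s3 s2 = n s2 * K s2 s3"
    using double_count[of s1 s3] double_count[of s2 s3] n3 by auto
  have K01: "K s s3 * K s s3 = K s s3" if s: "s \<in> {s1, s2, s3}" for s
  proof -
    obtain x where "\<alpha> x = s" using cell_rep[OF s] .
    then show ?thesis by (simp add: Kz adj_def)
  qed
  define r where "r = - p - e1 * (1 + a)"
  \<comment> \<open>if \<open>e1 \<noteq> e2\<close>, then \<open>a = - 1\<close>\<close>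
  have r2: "r = - p - e2 * (1 + a)" using e by (auto simp: r_def a)
  have "n s1 * K s1 s2 - K s1 s2 * K s2 s1 = r * (n s1 - 1)"
  proof -
    have "K s1 s1 * K s1 s1 = e1 * ((n s1 - 1) * (n s1 - 1))"
      using e by (auto simp: K11)
    moreover have "n s1 * (K s1 s1 + K s1 s2 + K s1 s3) = n s1 * (s1 * s1 - p)"
      using degree_eq[of s1] by simp
    ultimately show ?thesis
      using quotient_eq[of s1 s1] K01[of s1] e by (auto simp: K11 K31 r_def algebra_simps)
  qed
  moreover have "n s2 * K s2 s1 - K s1 s2 * K s2 s1 = r * (n s2 - 1)"
  proof -
    have "K s2 s2 * K s2 s2 = e2 * ((n s2 - 1) * (n s2 - 1))"
      using e by (auto simp: K22)
    moreover have "n s2 * (K s2 s1 + K s2 s2 + K s2 s3) = n s2 * (s2 * s2 - p)"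
      using degree_eq[of s2] by simp
    ultimately show ?thesis
      using quotient_eq[of s2 s2] K01[of s2] e by (auto simp: K22 K31 r2 algebra_simps)
  qed
  moreover have "n s1 * K s1 s2 - K s1 s2 * K s2 s1 \<noteq> 0"
    using mixed full_sym[of s1 s2] by (auto simp: mult.commute)
  ultimately show nn: "n s1 = n s2" using dc by auto
  show "K s1 s2 = K s2 s1" using dc nn n by simp
qed

text \<open>
  The vertex of the third cell is adjacent to the cell \<open>s1\<close> and possibly to the cell \<open>s2\<close>. In all
  cases but one, two of the products \<open>s1 * s2\<close>, \<open>s1 * s3\<close>, \<open>s2 * s3\<close> coincide, or \<open>s1 * s2 = 0\<close>, or the
  cells \<open>s1\<close> and \<open>s2\<close> have equal degrees. The exception, two complete cells of which only \<open>s1\<close> is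
  joined to the third cell, leads to \<open>5 * s3\<^sup>2 = - 1\<close>.
\<close>

lemma mixed_False_aux:
  assumes mixed: "K s1 s2 \<noteq> 0" "K s1 s2 \<noteq> n s2"
    and e: "e1 \<in> {0, 1}" "e2 \<in> {0, 1}"
    and V1: "\<forall>x y. \<alpha> x = s1 \<longrightarrow> \<alpha> y = s1 \<longrightarrow> adj E x y = e1 * of_bool (x \<noteq> y)"
    and V2: "\<forall>x y. \<alpha> x = s2 \<longrightarrow> \<alpha> y = s2 \<longrightarrow> adj E x y = e2 * of_bool (x \<noteq> y)"
    and n3: "n s3 = 1" and K13: "K s1 s3 = 1" and K23: "K s2 s3 \<in> {0, 1}"
  shows False
proof -
  note ms = mixed_sizes[OF mixed e V1 V2 n3]
  define b m where "b = K s1 s2" and "m = n s1"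
  have s: "s1 > 0" "s2 > 0" "s3 > 0" using cell_pos by auto
  have K33: "K s3 s3 = 0" using K_self_le[of s3] K_nonneg[of s3 s3] n3 by simp
  have K31: "K s3 s1 = m" using double_count[of s1 s3] n3 K13 by (simp add: m_def)
  have K32: "K s3 s2 = m * K s2 s3" using double_count[of s2 s3] n3 ms(3) by (simp add: m_def)
  have b: "K s1 s2 = b" "K s2 s1 = b" and m: "n s1 = m" "n s2 = m"
    using ms by (auto simp: b_def m_def)
  note a = ms(1)
  have K11: "K s1 s1 = e1 * (m - 1)" "K s2 s2 = e2 * (m - 1)" using ms m by auto
  note simps = b m a K11 K31 K32 K33 K13 n3
  have q12: "(e1 + e2) * b + K s2 s3 = s1 * s2" using ms(2) by (simp add: simps algebra_simps)
  have q13: "e1 * (m - 1) + b * K s2 s3 = s1 * s3 - (e1 + e2)"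
    using quotient_eq[of s1 s3] distinct by (simp add: simps)
  have q23: "b + e2 * (m - 1) * K s2 s3 = s2 * s3 - (e1 + e2) * K s2 s3"
    using quotient_eq[of s2 s3] distinct by (simp add: simps algebra_simps)
  have d1: "e1 * (m - 1) + b + 1 = s1 * s1 - p" using degree_eq[of s1] by (simp add: simps)
  have d2: "b + e2 * (m - 1) + K s2 s3 = s2 * s2 - p" using degree_eq[of s2] by (simp add: simps)
  have d3: "m + m * K s2 s3 = s3 * s3 - p" using degree_eq[of s3] by (simp add: simps)
  have ne: "s1 * s1 \<noteq> s2 * s2" using distinct s
    by (simp add: square_eq_iff)
  have c12: "s1 * s2 \<noteq> s2 * s3" "s1 * s2 \<noteq> s1 * s3" using s distinct by auto
  show False
  proof (cases "K s2 s3 = 1")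
    case True
    note t = q12 q13 q23 d1 d2
    show False
      using e t[unfolded True] ne c12 by (auto simp: algebra_simps)
  next
    case False
    then have f: "K s2 s3 = 0" using K23 by auto
    note t = q12[unfolded f] q13[unfolded f] q23[unfolded f] d1 d2[unfolded f] d3[unfolded f]
    have "s1 * s2 > 0" using s by simp
    then have "e1 = 1" "e2 = 1" using e t c12 by auto
    with t have u: "2 * b = s1 * s2" "m + 1 = s1 * s3" "b = s2 * s3" "m + b = s1 * s1 - p"
      "m - 1 + b = s2 * s2 - p" "m = s3 * s3 - p" by auto
    have s1: "s1 = 2 * s3" using u(1,3) s by auto
    define t where "t = s3 * s3"
    have "b = 3 * t" using u(4,6) by (simp add: s1 t_def)
    moreover have "s2 * s2 = 4 * t - 1" using u(4,5) by (simp add: s1 t_def)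
    moreover have "b * b = s2 * s2 * t" using u(3) by (simp add: t_def mult_ac)
    ultimately have "(3 * t) * (3 * t) = (4 * t - 1) * t" by simp
    then have "t * (5 * t + 1) = 0" by (simp add: algebra_simps)
    moreover have "t > 0" using s by (simp add: t_def)
    ultimately show False by (auto simp: add_pos_pos)
  qed
qed

lemma mixed_False:
  assumes mixed: "K s1 s2 \<noteq> 0" "K s1 s2 \<noteq> n s2"
    and e: "e1 \<in> {0, 1}" "e2 \<in> {0, 1}"
    and V1: "\<forall>x y. \<alpha> x = s1 \<longrightarrow> \<alpha> y = s1 \<longrightarrow> adj E x y = e1 * of_bool (x \<noteq> y)"
    and V2: "\<forall>x y. \<alpha> x = s2 \<longrightarrow> \<alpha> y = s2 \<longrightarrow> adj E x y = e2 * of_bool (x \<noteq> y)"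
    and n3: "n s3 = 1"
  shows False
proof -
  interpret r: three_cells E \<alpha> a p s2 s1 s3 by (rule three_cells_swap12)
  have 01: "K s s3 \<in> {0, 1}" for s
  proof -
    have "K s s3 \<in> \<int>" "0 \<le> K s s3" "K s s3 \<le> 1" using K_Ints K_nonneg K_le n3 by metis+
    then show ?thesis by (auto elim!: Ints_cases)
  qed
  have "K s1 s3 = 1 \<or> K s2 s3 = 1"
  proof (rule ccontr)
    assume "\<not> ?thesis"
    then have "K s1 s3 = 0" "K s2 s3 = 0" using 01 by auto
    then have z: "K s3 s1 = 0" "K s3 s2 = 0" using zero_sym[of s1 s3] zero_sym[of s2 s3] by auto
    interpret p132: three_cells E \<alpha> a p s1 s3 s2 by (rule three_cells_swap23)
    interpret p312: three_cells E \<alpha> a p s3 s1 s2 by (rule p132.three_cells_swap12)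
    show False using p312.isolated_False z by simp
  qed
  then show False
  proof
    assume "K s1 s3 = 1"
    then show False using mixed_False_aux[OF mixed e V1 V2 n3] 01 by blast
  next
    assume "K s2 s3 = 1"
    moreover have "K s2 s1 \<noteq> 0" "K s2 s1 \<noteq> n s1"
      using mixed full_sym[of s1 s2] zero_sym[of s1 s2] by auto
    ultimately show False
      using r.mixed_False_aux[OF _ _ e(2,1) V2 V1 n3] 01 by blast
  qed
qed

end

section \<open>Invariants of the coherent closure\<close>

lemma coherent_rank_eq:
  assumes "coherent_algebra A"
  shows "coherent_rank A = card (range (pos_indicator A))"
  unfolding coherent_rank_def
  using the1_equality[OF ex1_standard_basis[OF assms] standard_basis_pos_indicator[OF assms]] by simp

text \<open>
  A function of positions that is constant on the classes of positions not separated by the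
  matrices in \<open>A\<close>.
\<close>

definition class_invariant :: "(complex ^ 'v ^ 'v) set \<Rightarrow> ('v \<times> 'v \<Rightarrow> 'b) \<Rightarrow> bool" where
  "class_invariant A f \<longleftrightarrow> (\<forall>p q. same_pos A p q \<longrightarrow> f p = f q)"

lemma class_invariantD: "class_invariant A f \<Longrightarrow> same_pos A p q \<Longrightarrow> f p = f q"
  unfolding class_invariant_def by blast

lemma card_range_le_rank:
  fixes A :: "(complex ^ 'v::finite ^ 'v) set"
  assumes "coherent_algebra A" and f: "class_invariant A f"
  shows "card (range f) \<le> coherent_rank A"
proof -
  define r where "r M = (SOME p. pos_indicator A p = M)" for M
  have "f p = f (r (pos_indicator A p))" for p
  proof -
    have "pos_indicator A (r (pos_indicator A p)) = pos_indicator A p"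
      unfolding r_def by (rule someI_ex) blast
    then show ?thesis using class_invariantD[OF f] by (metis pos_indicator_eq_iff)
  qed
  then have "range f \<subseteq> (\<lambda>M. f (r M)) ` range (pos_indicator A)" by auto
  then have "card (range f) \<le> card ((\<lambda>M. f (r M)) ` range (pos_indicator A))"
    by (intro card_mono) auto
  also have "\<dots> \<le> card (range (pos_indicator A))" by (rule card_image_le) simp
  finally show ?thesis by (simp add: coherent_rank_eq[OF assms(1)])
qed

lemma class_invariant_mem: "M \<in> A \<Longrightarrow> class_invariant A (\<lambda>p. M $ fst p $ snd p)"
  by (auto simp: class_invariant_def same_pos_def)

text \<open>
  Converse of \<open>class_invariant_mem\<close>: a coherent algebra contains every matrix that is constant on
  its classes.
\<close>

lemma mem_class_invariant:
  fixes A :: "(complex ^ 'v::finite ^ 'v) set"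
  assumes A: "coherent_algebra A" and M: "class_invariant A (\<lambda>p. M $ fst p $ snd p)"
  shows "M \<in> A"
proof -
  have sub: "cmat.subspace A" using A by (simp add: coherent_algebra_def)
  define r where "r N = (SOME p. pos_indicator A p = N)" for N
  define c where "c N = M $ fst (r N) $ snd (r N)" for N
  have c: "c (pos_indicator A (i, j)) = M $ i $ j" for i j
  proof -
    have "pos_indicator A (r (pos_indicator A (i, j))) = pos_indicator A (i, j)"
      unfolding r_def by (rule someI_ex) blast
    then show ?thesis
      using class_invariantD[OF M, of "r (pos_indicator A (i, j))" "(i, j)"]
      by (simp add: c_def pos_indicator_eq_iff)
  qed
  have "M = (\<Sum>N\<in>range (pos_indicator A). map_matrix ((*) (c N)) N)"
    using sum_pos_indicator[where c = c and A = A]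
    by (simp add: vec_eq_iff map_matrix_def sum_component c)
  also have "\<dots> \<in> A"
    by (intro cmat.subspace_sum[OF sub] cmat.subspace_scale[OF sub]) (auto intro: pos_indicator_in[OF A])
  finally show ?thesis .
qed

lemma same_pos_swap:
  assumes "coherent_algebra A" "same_pos A p q"
  shows "same_pos A (snd p, fst p) (snd q, fst q)"
  unfolding same_pos_def
proof
  fix M assume "M \<in> A"
  then have "transpose M \<in> A" using assms by (simp add: coherent_algebra_def)
  then show "M $ fst (snd p, fst p) $ snd (snd p, fst p) = M $ fst (snd q, fst q) $ snd (snd q, fst q)"
    using assms(2) by (auto simp: same_pos_def transpose_def)
qed

lemma class_invariant_snd:
  assumes "coherent_algebra A" "class_invariant A (\<lambda>p. f (fst p))"
  shows "class_invariant A (\<lambda>p. f (snd p))"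
  using assms same_pos_swap[OF assms(1)] unfolding class_invariant_def by fastforce

lemma class_invariant_diag:
  assumes "coherent_algebra A"
  shows "class_invariant A (\<lambda>p. fst p = snd p)"
proof -
  have "mat 1 \<in> A" using assms by (simp add: coherent_algebra_def)
  from class_invariantD[OF class_invariant_mem[OF this]] show ?thesis
    unfolding class_invariant_def by (fastforce simp: mat_def split: if_splits)
qed

lemma class_invariant_adjacent:
  "class_invariant (coherent_closure E) (\<lambda>p. E (fst p) (snd p))"
  using class_invariantD[OF class_invariant_mem[OF adjacency_in_closure[of E]]]
  unfolding class_invariant_def by (fastforce simp: adjacency_matrix_def split: if_splits)

text \<open>
  The number of neighbours with an invariant property \<open>P\<close> is an entry of the product of the
  adjacency matrix with the matrix that has rows of ones at the vertices satisfying \<open>P\<close> and zero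
  rows elsewhere.
\<close>

lemma class_invariant_count:
  fixes E :: "'v::finite \<Rightarrow> 'v \<Rightarrow> bool"
  assumes "class_invariant (coherent_closure E) (\<lambda>p. P (fst p))"
  shows "class_invariant (coherent_closure E) (\<lambda>p. card {w. E (fst p) w \<and> P w})"
proof -
  let ?W = "coherent_closure E"
  define N :: "complex ^ 'v ^ 'v" where "N = (\<chi> w y. of_bool (P w))"
  have "N \<in> ?W"
    by (rule mem_class_invariant[OF coherent_algebra_closure])
      (use assms in \<open>simp add: N_def class_invariant_def\<close>)
  then have "adjacency_matrix E ** N \<in> ?W"
    using coherent_algebra_closure[of E] adjacency_in_closure[of E] by (simp add: coherent_algebra_def)
  moreover have "(adjacency_matrix E ** N) $ x $ y = of_nat (card {w. E x w \<and> P w})" for x y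
  proof -
    have "(adjacency_matrix E ** N) $ x $ y = (\<Sum>w\<in>UNIV. of_bool (E x w \<and> P w))"
      by (auto simp: matrix_matrix_mult_def N_def adjacency_matrix_def intro!: sum.cong
          simp del: sum_mult_of_bool_eq sum_of_bool_eq)
    then show ?thesis by simp
  qed
  ultimately show ?thesis
    using class_invariant_mem[of "adjacency_matrix E ** N" ?W] by (simp add: class_invariant_def)
qed

lemma class_invariant_degree: "class_invariant (coherent_closure E) (\<lambda>p. degree E (fst p))"
  using class_invariant_count[where P = "\<lambda>_. True" and E = E]
  by (simp add: degree_def class_invariant_def)

section \<open>Graphs of small coherent rank\<close>

lemma small_rank_equitable:
  fixes E :: "'v::finite \<Rightarrow> 'v \<Rightarrow> bool" and \<alpha> :: "'v \<Rightarrow> real"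
  assumes inv: "class_invariant (coherent_closure E) (\<lambda>p. \<alpha> (fst p))"
    and c3: "card (range \<alpha>) = 3" and rank: "coherent_rank (coherent_closure E) < 16"
    and eq: "\<alpha> x = \<alpha> y"
  shows "card {w. E x w \<and> \<alpha> w = s} = card {w. E y w \<and> \<alpha> w = s}"
proof -
  \<comment> \<open>at least four values of \<open>f\<close> would give sixteen pairs of values\<close>
  define f where "f x = (\<alpha> x, card {w. E x w \<and> \<alpha> w = s})" for x
  have "class_invariant (coherent_closure E) (\<lambda>p. card {w. E (fst p) w \<and> \<alpha> w = s})"
    by (rule class_invariant_count) (use inv in \<open>auto simp: class_invariant_def\<close>)
  with inv have f1: "class_invariant (coherent_closure E) (\<lambda>p. f (fst p))"
    by (simp add: class_invariant_def f_def)
  have "class_invariant (coherent_closure E) (\<lambda>p. (f (fst p), f (snd p)))"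
    using f1 class_invariant_snd[OF coherent_algebra_closure f1] by (simp add: class_invariant_def)
  from card_range_le_rank[OF coherent_algebra_closure this]
  have "card (range (\<lambda>p. (f (fst p), f (snd p)))) < 16" using rank by simp
  also have "range (\<lambda>p. (f (fst p), f (snd p))) = range f \<times> range f"
    by (auto intro!: image_eqI[where x = "(_, _)"])
  finally have "card (range f) * card (range f) < 4 * 4" by (simp add: card_cartesian_product)
  then have "card (range f) < 4" by (meson mult_le_mono not_le)
  moreover have fst: "fst ` range f = range \<alpha>" by (force simp: f_def)
  ultimately have "card (range f) = card (fst ` range f)"
    using c3 card_image_le[of "range f" fst] by simp
  then have "inj_on fst (range f)" by (intro eq_card_imp_inj_on) auto
  moreover have "fst (f x) = fst (f y)" using eq by (simp add: f_def)
  ultimately have "f x = f y" by (auto dest: inj_onD)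
  then show ?thesis by (simp add: f_def)
qed

context three_cells
begin

text \<open>
  The type of a pair of vertices: the two cells, and whether the vertices are equal or adjacent.
\<close>

definition pair_type :: "'v \<times> 'v \<Rightarrow> real \<times> real \<times> bool \<times> bool" where
  "pair_type q = (\<alpha> (fst q), \<alpha> (snd q), fst q = snd q, E (fst q) (snd q))"

text \<open>
  The types of the pairs between two cells.
\<close>

definition block :: "real \<Rightarrow> real \<Rightarrow> (real \<times> real \<times> bool \<times> bool) set" where
  "block s t = pair_type ` {q. \<alpha> (fst q) = s \<and> \<alpha> (snd q) = t}"

lemma block_memI: "\<alpha> x = s \<Longrightarrow> \<alpha> y = t \<Longrightarrow> (s, t, x = y, E x y) \<in> block s t"
  unfolding block_def by (rule image_eqI[where x = "(x, y)"]) (auto simp: pair_type_def)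

lemma finite_block: "finite (block s t)"
  by (simp add: block_def)

lemma sum_block:
  "card (block s1 s1) + card (block s2 s2) + card (block s3 s3) + card (block s1 s2) + card (block s2 s1)
   + card (block s1 s3) + card (block s3 s1) + card (block s2 s3) + card (block s3 s2) \<le> card (range pair_type)"
proof -
  let ?S = "{s1, s2, s3}"
  have "(\<Sum>i\<in>?S \<times> ?S. card (block (fst i) (snd i))) = card (\<Union>i\<in>?S \<times> ?S. block (fst i) (snd i))"
    by (rule card_UN_disjoint[symmetric]) (auto simp: finite_block, auto simp: block_def pair_type_def)
  also have "\<dots> \<le> card (range pair_type)" by (rule card_mono) (auto simp: block_def)
  finally show ?thesis
    using distinct by (simp add: sum.cartesian_product'[symmetric])
qed

lemma card_block_ge_1:
  assumes "s \<in> {s1, s2, s3}" "t \<in> {s1, s2, s3}"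
  shows "card (block s t) \<ge> 1"
proof -
  obtain x y where "\<alpha> x = s" "\<alpha> y = t" using cell_rep assms by metis
  then have "block s t \<noteq> {}" using block_memI by blast
  then have "card (block s t) \<noteq> 0" using finite_block by simp
  then show ?thesis by linarith
qed

lemma card_block_mixed:
  assumes "s \<in> {s1, s2, s3}" "K s t \<noteq> 0" "K s t \<noteq> n t" "s \<noteq> t"
  shows "card (block s t) \<ge> 2"
proof -
  obtain x where x: "\<alpha> x = s" using cell_rep assms by metis
  obtain y z where "\<alpha> y = t" "E x y" "\<alpha> z = t" "\<not> E x z"
    using K_zero_iff[OF x] K_full_iff[OF x] assms by metis
  moreover from this have "x \<noteq> y" "x \<noteq> z" using x assms by auto
  ultimately have "{(s, t, False, True), (s, t, False, False)} \<subseteq> block s t"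
    using block_memI[OF x, of y t] block_memI[OF x, of z t] by simp
  from card_mono[OF finite_block this] show ?thesis by simp
qed

lemma card_block_diag:
  assumes "s \<in> {s1, s2, s3}" "n s \<noteq> 1"
  shows "card (block s s) \<ge> 2"
    and "\<lbrakk>\<alpha> x = s; \<alpha> y = s; E x y; \<alpha> v = s; \<alpha> w = s; v \<noteq> w; \<not> E v w\<rbrakk> \<Longrightarrow> card (block s s) \<ge> 3"
proof -
  have nE: "\<not> E z z" for z using irrE by (auto dest: irreflpD)
  obtain z where z: "\<alpha> z = s" using cell_rep[OF assms(1)] .
  then have T: "(s, s, True, False) \<in> block s s" using block_memI[OF z z] nE by simp
  have "{w. \<alpha> w = s} \<noteq> {z}" using assms(2) by (auto simp: n_card)
  then obtain u where u: "\<alpha> u = s" "u \<noteq> z" using z by auto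
  have "{(s, s, True, False), (s, s, False, E u z)} \<subseteq> block s s"
    using T block_memI[OF u(1) z] u(2) by simp
  from card_mono[OF finite_block this] show "card (block s s) \<ge> 2" by simp
  assume a: "\<alpha> x = s" "\<alpha> y = s" "E x y" "\<alpha> v = s" "\<alpha> w = s" "v \<noteq> w" "\<not> E v w"
  have "x \<noteq> y" using a nE by auto
  then have "{(s, s, True, False), (s, s, False, True), (s, s, False, False)} \<subseteq> block s s"
    using T block_memI[OF a(1,2)] block_memI[OF a(4,5)] a by simp
  from card_mono[OF finite_block this] show "card (block s s) \<ge> 3" by simp
qed

text \<open>
  A partially joined pair of cells forces \<open>13\<close> types, and exactly \<open>13\<close> types force the configuration
  of \<open>mixed_False\<close>.
\<close>

lemma mixed_card:
  assumes mixed: "K s1 s2 \<noteq> 0" "K s1 s2 \<noteq> n s2"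
  shows "card (range pair_type) \<ge> 14"
proof (rule ccontr)
  assume "\<not> ?thesis"
  then have le: "card (range pair_type) \<le> 13" by simp
  have mixed': "K s2 s1 \<noteq> 0" "K s2 s1 \<noteq> n s1"
    using mixed full_sym[of s1 s2] zero_sym[of s1 s2] by auto
  \<comment> \<open>a single vertex is adjacent to all or none of the vertices of another cell\<close>
  have ne: "n t \<noteq> 1" if "K s t \<noteq> 0" "K s t \<noteq> n t" for s t
  proof
    assume "n t = 1"
    then have "K s t \<in> \<int>" "0 \<le> K s t" "K s t \<le> 1" using K_Ints K_nonneg K_le by metis+
    then show False using that \<open>n t = 1\<close> by (auto elim!: Ints_cases)
  qed
  note n1 = ne[OF mixed'] and n2 = ne[OF mixed]
  have "card (block s1 s2) \<ge> 2" "card (block s2 s1) \<ge> 2"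
    using card_block_mixed[OF _ mixed] card_block_mixed[OF _ mixed'] distinct by auto
  moreover have "card (block s1 s1) \<ge> 2" "card (block s2 s2) \<ge> 2"
    using card_block_diag(1) n1 n2 by auto
  moreover have "card (block s1 s3) \<ge> 1" "card (block s3 s1) \<ge> 1" "card (block s2 s3) \<ge> 1"
     "card (block s3 s2) \<ge> 1" "card (block s3 s3) \<ge> 1"
    using card_block_ge_1 by auto
  ultimately have c: "card (block s1 s1) < 3" "card (block s2 s2) < 3" "card (block s3 s3) < 2"
    using sum_block le by linarith+
  have n3: "n s3 = 1" using card_block_diag(1)[of s3] c by force
  have ex: "\<exists>e\<in>{0, 1}. \<forall>x y. \<alpha> x = s \<longrightarrow> \<alpha> y = s \<longrightarrow> adj E x y = e * of_bool (x \<noteq> y)"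
    if "s \<in> {s1, s2, s3}" "n s \<noteq> 1" "card (block s s) < 3" for s
  proof (cases "\<exists>x y. \<alpha> x = s \<and> \<alpha> y = s \<and> E x y")
    case True
    then obtain x y where "\<alpha> x = s" "\<alpha> y = s" "E x y" by blast
    from card_block_diag(2)[OF that(1,2) this] that(3)
    have "\<forall>v w. \<alpha> v = s \<longrightarrow> \<alpha> w = s \<longrightarrow> v \<noteq> w \<longrightarrow> E v w"
      by (metis not_le)
    then show ?thesis by (intro bexI[of _ 1]) (auto simp: adj_self, auto simp: adj_def)
  next
    case False
    then show ?thesis by (intro bexI[of _ 0]) (auto simp: adj_def)
  qed
  obtain e1 e2 where "e1 \<in> {0, 1}" "e2 \<in> {0, 1}"
    "\<forall>x y. \<alpha> x = s1 \<longrightarrow> \<alpha> y = s1 \<longrightarrow> adj E x y = e1 * of_bool (x \<noteq> y)"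
    "\<forall>x y. \<alpha> x = s2 \<longrightarrow> \<alpha> y = s2 \<longrightarrow> adj E x y = e2 * of_bool (x \<noteq> y)"
    using ex[of s1] ex[of s2] n1 n2 c by blast
  then show False using mixed_False[OF mixed] n3 by blast
qed

lemma card_pair_type_ge_14: "card (range pair_type) \<ge> 14"
proof -
  interpret p132: three_cells E \<alpha> a p s1 s3 s2 by (rule three_cells_swap23)
  interpret p213: three_cells E \<alpha> a p s2 s1 s3 by (rule three_cells_swap12)
  interpret p231: three_cells E \<alpha> a p s2 s3 s1 by (rule p213.three_cells_swap23)
  show ?thesis
    using uniform_False mixed_card p132.mixed_card p231.mixed_card by blast
qed

end

theorem theorem6p1:
  fixes E :: "'v::finite \<Rightarrow> 'v \<Rightarrow> bool"
  assumes "in_G3 E" and "triregular E"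
  shows "coherent_rank (coherent_closure E) \<ge> 14"
proof (rule ccontr)
  assume "\<not> ?thesis"
  then have rank: "coherent_rank (coherent_closure E) < 14" by simp
  have E: "symp E" "irreflp E" "connected_graph E"
    using assms(1) by (auto simp: in_G3_def simple_graph_def)
  obtain a p :: real and \<alpha> where pos: "\<And>x. \<alpha> x > 0"
    and sq: "\<And>x y. (\<Sum>w\<in>UNIV. adj E x w * adj E w y) = \<alpha> x * \<alpha> y + a * adj E x y - p * of_bool (x = y)"
    by (rule rank_one_identity[OF assms(1)], rule that)
  have deg: "real (degree E x) = \<alpha> x * \<alpha> x - p" for x
  proof -
    have "adj E x w * adj E w x = of_bool (E x w)" for w
      using E(1) by (auto simp: adj_def dest: sympD)
    then show ?thesis using sq[of x x] E(2) by (simp add: degree_def adj_def irreflpD)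
  qed
  have \<alpha>_eq: "\<alpha> x = \<alpha> y \<longleftrightarrow> degree E x = degree E y" for x y
  proof
    assume "degree E x = degree E y"
    then have "\<alpha> x * \<alpha> x = \<alpha> y * \<alpha> y" using deg[of x] deg[of y] by simp
    then show "\<alpha> x = \<alpha> y" using pos[of x] pos[of y] by (auto simp: square_eq_iff)
  qed (use deg[of x] deg[of y] in simp)
  have c3: "card (range \<alpha>) = 3"
  proof -
    have "bij_betw (\<lambda>s. degree E (SOME x. \<alpha> x = s)) (range \<alpha>) (range (degree E))"
    proof (rule bij_betw_imageI)
      have *: "degree E (SOME y. \<alpha> y = \<alpha> x) = degree E x" for x
        by (rule someI2[of _ x]) (auto simp: \<alpha>_eq)
      show "inj_on (\<lambda>s. degree E (SOME x. \<alpha> x = s)) (range \<alpha>)"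
        by (auto simp: inj_on_def *) (simp add: \<alpha>_eq)
      show "(\<lambda>s. degree E (SOME x. \<alpha> x = s)) ` range \<alpha> = range (degree E)"
        by (simp add: image_image *)
    qed
    then show ?thesis using assms(2) by (simp add: bij_betw_same_card triregular_def)
  qed
  then obtain s1 s2 s3 where s: "range \<alpha> = {s1, s2, s3}" "s1 \<noteq> s2" "s1 \<noteq> s3" "s2 \<noteq> s3"
    by (auto simp: card_3_iff)
  have inv: "class_invariant (coherent_closure E) (\<lambda>p. \<alpha> (fst p))"
    using class_invariant_degree[of E] by (simp add: class_invariant_def \<alpha>_eq)
  interpret three_cells E \<alpha> a p s1 s2 s3
  proof
    fix x y s assume eq: "\<alpha> x = \<alpha> y"
    have "(\<Sum>w\<in>UNIV. adj E x w * of_bool (\<alpha> w = s)) = real (card {w. E x w \<and> \<alpha> w = s})" for x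
      unfolding adj_def of_bool_conj[symmetric] by simp
    then show "(\<Sum>w\<in>UNIV. adj E x w * of_bool (\<alpha> w = s)) = (\<Sum>w\<in>UNIV. adj E y w * of_bool (\<alpha> w = s))"
      using small_rank_equitable[OF inv c3 _ eq] rank by simp
  qed (use E pos sq s in auto)
  have "class_invariant (coherent_closure E) pair_type"
    using inv class_invariant_snd[OF coherent_algebra_closure inv]
      class_invariant_diag[OF coherent_algebra_closure] class_invariant_adjacent[of E]
    unfolding class_invariant_def pair_type_def by blast
  from card_range_le_rank[OF coherent_algebra_closure this]
  show False using rank card_pair_type_ge_14 by simp
qed

end
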